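(* Let $Z=(X,T)$ be an HiMM, modified by a sequence of modifications $m_{\mathrm{seq}}$ (possibly empty, e.g. if $Z$ is only initialised) and marked using the procedure $\mathrm{Mark}$ (following the marking convention stated in the context). Then the algorithm $\mathrm{Compute\_optimal\_exits}$ applied to $Z$ returns the correct optimal exit costs; that is, for every MM $M\in X$ and every input $x\in\Sigma$, the value it provides for $c^M_x$ equals the optimal exit cost of $M$ with $x$ in $Z$.
   Context: **Mealy machines.** $f:A\rightharpoonup B$ denotes a partial function, and $f(a)=\emptyset$ means that $f$ is not defined at $a$. $\mathbb{R}^+=\{x\in\mathbb{R}:x\ge 0\}$. A Mealy machine (MM) is a tuple $M=(Q,\Sigma,\Lambda,\delta,\gamma,s)$ with finite state set $Q=Q(M)$, finite input set $\Sigma$, finite output set $\Lambda$, transition function $\delta=\delta_M:Q\times\Sigma\rightharpoonup Q$, output function $\gamma=\gamma_M:Q\times\Sigma\to\Lambda$, and start state $s=s(M)\in Q$. Throughout $\Lambda\subset\mathbb{R}^+$ (outputs are costs). **HiMMs.** A hierarchical Mealy machine (HiMM) is a pair $Z=(X,T)$, where $X$ is a set of MMs with common input set $\Sigma$ and common output set $\Lambda$ and pairwise disjoint state sets, and $T$ is a tree with nodes given by $X$ in which each $M\in X$ has $|Q(M)|$ outgoing arcs $M\xrightarrow{q}N_q$, $q\in Q(M)$, where either $N_q\in X$ (state $q$ of $M$ corresponds to the MM $N_q$ one layer below) or $N_q=\emptyset$ (terminal arc: $q$ has no further refinement). Put $Q_Z=\bigcup_{M\in X}Q(M)$ and $S_Z=\{q\in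 Q_Z:N_q=\emptyset\}$ (the states of $Z$). - Start function $\mathrm{start}:X\to S_Z$: $\mathrm{start}(M)=\mathrm{start}(N)$ if $(M\xrightarrow{s(M)}N)\in T$ with $N\in X$, and $\mathrm{start}(M)=s(M)$ otherwise. - Hierarchical transition function $\psi:Q_Z\times\Sigma\rightharpoonup S_Z$: for $q\in Q(M)$ and $v=\delta_M(q,x)$, $\psi(q,x)=\mathrm{start}(Y)$ if $v\neq\emptyset$ and $(M\xrightarrow{v}Y)\in T$ with $Y\in X$; $\psi(q,x)=v$ if $v\ne\emptyset$ otherwise; $\psi(q,x)=\psi(w,x)$ if $v=\emptyset$ and $(W\xrightarrow{w}M)\in T$ with $W\in X$; $\psi(q,x)=\emptyset$ if $v=\emptyset$ otherwise. - Hierarchical output function $\chi:Q_Z\times\Sigma\rightharpoonup\Lambda$: with the same $v$, $\chi(q,x)=\gamma_M(q,x)$ if $v\neq\emptyset$; $\chi(q,x)=\chi(w,x)$ if $v=\emptyset$ and $(W\xrightarrow{w}M)\in T$ with $W\in X$; $\chi(q,x)=\emptyset$ if $v=\emptyset$ otherwise. A trajectory of $Z$ is a sequence $(q_i,x_i)_{i=1}^N\in(S_Z\times\Sigma)^N$ with $q_{i+1}=\psi(q_i,x_i)\in S_Z$ for $1\le i\le N-1$. **Optimal exit costs.** Let $M\in X$. A state $q\in S_Z$ is contained in $M$ if it is a descendant of $M$ in $T$ (i.e. $q$ is a state of $M$ or of an MM that is a descendant of $M$). An $(M,x)$-exit trajectory is a trajectory $(q_i,x_i)_{i=1}^N$ with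 $q_1=\mathrm{start}(M)$ such that all $q_i$ are contained in $M$, while $\psi(q_N,x_N)$ is not, and $x_N=x$ (i.e. it exits $M$ with $x$). Its $(M,x)$-exit cost is $\sum_{i=1}^{N-1}\chi(q_i,x_i)$ (the cost of $(q_N,x_N)$ is excluded, since that transition happens outside the subtree with root $M$). The optimal exit cost of $M$ with $x$ is the minimum over all $(M,x)$-exit costs. **Modifications.** - State addition: given an HiMM $Z$, an MM $M$ of $Z$ with state set $Q$, and an HiMM $Z_{\mathrm{add}}$, form a new HiMM whose tree equals that of $Z$ except that a new arc $M\xrightarrow{q}N$ is added from $M$ to the root MM $N$ of the tree of $Z_{\mathrm{add}}$ (connecting $Z_{\mathrm{add}}$ to $M$), with $q\notin Q$ an arbitrary but distinct state, and $M$ has updated its state set to $Q\cup\{q\}$. Adding just a state is identical except that the new arc is a terminal arc $M\xrightarrow{q}\emptyset$. - State subtraction: remove a state $q\in Q(M)$ from an MM $M$ of $Z$, where $q$ is not the start state of $M$; the new tree equals the old one except that the $q$-arc from $M$ is removed, and $M$ becomes the modified MM with state $q$ removed. - Arc modification: replace an MM $M=(Q,\Sigma,\Lambda,\delta,\gamma,s)$ of $Z$ by $(Q,\Sigma,\Lambda,\delta',\gamma',s')$ with new $\delta':Q\times\Sigma\rightharpoonup Q$, $\gamma':Q\times\Sigma\to\Lambda$, $s'\in Q$. - Composition: given an MM $M$ with states $q_1,\dots,q_{|Q|}$ and HiMMs $Z_1,\dots,Z_n$, $n\le|Q|$, form the HiMM whose tree has root $M$ and arcs $M\xrightarrow{q_i}R_i$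 for $1\le i\le n$, with $R_i$ the root MM of the tree of $Z_i$ (connecting $Z_i$ to $M$), and $M\xrightarrow{q_i}\emptyset$ for $i>n$. **Marking.** Each MM of an HiMM is either marked or unmarked. The procedure $\mathrm{Mark}$, run after a modification concerning the MM $M$, marks $M$ and, if the modification is not a composition, also marks all ancestors of $M$ in the tree of the modified HiMM. **Marking convention.** When an HiMM is initialised, all its MMs are by default marked, since no optimal exit costs have been computed. Whenever an HiMM is modified, it is marked accordingly by $\mathrm{Mark}$. The algorithm $\mathrm{Compute\_optimal\_exits}$ below may also be called on the HiMMs along the way, between modifications. The HiMM $Z_{\mathrm{add}}$ in a state addition and the HiMMs $Z_1,\dots,Z_n$ in a composition are already marked according to this convention (some of their optimal exit costs may already have been computed by the algorithm), and are not re-marked when they become part of a larger HiMM. **Algorithm $\mathrm{Compute\_optimal\_exits}(Z)$.** Run $\mathrm{Optimal\_exit}(M_0)$ for the root MM $M_0$ of $T$, where $\mathrm{Optimal\_exit}(M)$ is defined recursively: if $M$ is not marked, return the already computed $(c^M_x,z^M_x)_{x\in\Sigma}$. Otherwise, for each $q\in Q(M)$ set $c^q_x=0$ for all $x\in\Sigma$ if $q\in S_Z$, and otherwise set $(c^q_x,z^q_x)_{x\in\Sigma}$ to the result of $\mathrm{Optimal\_exit}(N_q)$. Then construct the augmented MM $\hat M$ with states $Q(M)\cup\{E_x\}_{x\in\Sigma}$, inputs $\Sigma$, start state $s(M)$, and, for $q\in Q(M)$, $y\in\Sigma$: $\hat\delta(q,y)=\delta_M(q,y)$ and $\hat\gamma(q,y)=c^q_y+\gamma_M(q,y)$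 if $\delta_M(q,y)\neq\emptyset$; $\hat\delta(q,y)=E_y$ and $\hat\gamma(q,y)=c^q_y$ otherwise (values at the states $E_x$ are immaterial). Run Dijkstra's algorithm in $\hat M$ from $s(M)$ and let $c^M_x$ be the minimal cumulative cost of reaching $E_x$ and $z^M_x$ a corresponding optimal trajectory. Unmark $M$, and return $(c^M_x,z^M_x)_{x\in\Sigma}$.
   Formalization: Exiting M is read as the last transition not being performed inside the subtree of M; for the literal condition that ψ(q_N,x_N) is not contained in M, the claim is made only when the arc into M does not lead x straight back into M, as otherwise no literal exit trajectory exists. *)

theory Defs
  imports Complex_Main "HOL-Library.Extended_Real"
begin

section \<open>Mealy machines\<close>

text \<open>
  The output type is a parameter: the machines of a hierarchy have real costs, whereas the
  augmented machines built by the algorithm have costs in \<^typ>\<open>ereal\<close>, since an exit may be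
  impossible (cost \<open>\<infinity>\<close>).
\<close>

record ('q, 'x, 'c) mm =
  states :: "'q set"
  inputs :: "'x set"
  outputs :: "'c set"
  delta :: "'q \<Rightarrow> 'x \<Rightarrow> 'q option"
  gamma :: "'q \<Rightarrow> 'x \<Rightarrow> 'c"
  init :: "'q"

definition is_mm :: "('q, 'x, real) mm \<Rightarrow> bool" where
  "is_mm M \<longleftrightarrow>
     finite (states M) \<and> finite (inputs M) \<and> finite (outputs M) \<and> outputs M \<subseteq> {0..} \<and>
     (\<forall>q x v. delta M q x = Some v \<longrightarrow> q \<in> states M \<and> x \<in> inputs M \<and> v \<in> states M) \<and>
     (\<forall>q\<in>states M. \<forall>x\<in>inputs M. gamma M q x \<in> outputs M) \<and>
     init M \<in> states M"


section \<open>Hierarchical Mealy machines\<close>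

text \<open>
  The arcs \<open>M \<midarrow>q\<rightarrow> N\<^sub>q\<close> of the tree are given by the function \<open>child\<close>: \<open>child Z M q = Some N\<close>
  if \<open>N\<^sub>q = N\<close> is a machine, and \<open>child Z M q = None\<close> if the \<open>q\<close>-arc of \<open>M\<close> is terminal.
\<close>

record ('q, 'x) himm =
  machines :: "('q, 'x, real) mm set"
  child :: "('q, 'x, real) mm \<Rightarrow> 'q \<Rightarrow> ('q, 'x, real) mm option"

definition edges :: "('q, 'x) himm \<Rightarrow> (('q, 'x, real) mm \<times> ('q, 'x, real) mm) set" where
  "edges Z = {(M, N). \<exists>q. child Z M q = Some N}"

definition is_root :: "('q, 'x) himm \<Rightarrow> ('q, 'x, real) mm \<Rightarrow> bool" where
  "is_root Z R \<longleftrightarrow> R \<in> machines Z \<and> (\<forall>M q. child Z M q \<noteq> Some R)"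

definition root_mm :: "('q, 'x) himm \<Rightarrow> ('q, 'x, real) mm" where
  "root_mm Z = (THE R. is_root Z R)"

definition is_tree :: "('q, 'x) himm \<Rightarrow> bool" where
  "is_tree Z \<longleftrightarrow>
     (\<forall>M q N. child Z M q = Some N \<longrightarrow> M \<in> machines Z \<and> q \<in> states M \<and> N \<in> machines Z) \<and>
     (\<exists>R. is_root Z R \<and> (\<forall>N\<in>machines Z. (R, N) \<in> (edges Z)\<^sup>*)) \<and>
     (\<forall>M q M' q' N. child Z M q = Some N \<and> child Z M' q' = Some N \<longrightarrow> M = M' \<and> q = q')"

definition is_himm :: "('q, 'x) himm \<Rightarrow> bool" where
  "is_himm Z \<longleftrightarrow>
     finite (machines Z) \<and>
     (\<forall>M\<in>machines Z. is_mm M) \<and>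
     (\<forall>M\<in>machines Z. \<forall>N\<in>machines Z. inputs M = inputs N \<and> outputs M = outputs N) \<and>
     (\<forall>M\<in>machines Z. \<forall>N\<in>machines Z. M \<noteq> N \<longrightarrow> states M \<inter> states N = {}) \<and>
     is_tree Z"

text \<open>\<open>all_states Z\<close> is \<open>Q\<^sub>Z\<close> and \<open>leaf_states Z\<close> is \<open>S\<^sub>Z\<close>.\<close>

definition all_states :: "('q, 'x) himm \<Rightarrow> 'q set" where
  "all_states Z = (\<Union>M\<in>machines Z. states M)"

definition leaf_states :: "('q, 'x) himm \<Rightarrow> 'q set" where
  "leaf_states Z = {q. \<exists>M\<in>machines Z. q \<in> states M \<and> child Z M q = None}"

definition all_inputs :: "('q, 'x) himm \<Rightarrow> 'x set" where
  "all_inputs Z = (\<Union>M\<in>machines Z. inputs M)"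

definition owner :: "('q, 'x) himm \<Rightarrow> 'q \<Rightarrow> ('q, 'x, real) mm" where
  "owner Z q = (THE M. M \<in> machines Z \<and> q \<in> states M)"

text \<open>\<open>parent_state Z M = Some w\<close> if \<open>M\<close> has an incoming arc \<open>W \<midarrow>w\<rightarrow> M\<close>; then \<open>W = owner Z w\<close>.\<close>

definition parent_state :: "('q, 'x) himm \<Rightarrow> ('q, 'x, real) mm \<Rightarrow> 'q option" where
  "parent_state Z M =
     (if \<exists>W w. child Z W w = Some M then Some (THE w. \<exists>W. child Z W w = Some M) else None)"

text \<open>
  The recursions below descend or climb the (finite) tree, so for hierarchies satisfying
  \<^const>\<open>is_himm\<close> they always end; \<^const>\<open>None\<close> then only stands for undefinedness.
\<close>

partial_function (tailrec) start :: "('q, 'x) himm \<Rightarrow> ('q, 'x, real) mm \<Rightarrow> 'q" where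
  "start Z M = (case child Z M (init M) of Some N \<Rightarrow> start Z N | None \<Rightarrow> init M)"

partial_function (option) psi :: "('q, 'x) himm \<Rightarrow> 'q \<Rightarrow> 'x \<Rightarrow> 'q option" where
  "psi Z q x =
     (case delta (owner Z q) q x of
        Some v \<Rightarrow> (case child Z (owner Z q) v of Some Y \<Rightarrow> Some (start Z Y) | None \<Rightarrow> Some v)
      | None \<Rightarrow> (case parent_state Z (owner Z q) of Some w \<Rightarrow> psi Z w x | None \<Rightarrow> None))"

partial_function (option) chi :: "('q, 'x) himm \<Rightarrow> 'q \<Rightarrow> 'x \<Rightarrow> real option" where
  "chi Z q x =
     (case delta (owner Z q) q x of
        Some v \<Rightarrow> Some (gamma (owner Z q) q x)
      | None \<Rightarrow> (case parent_state Z (owner Z q) of Some w \<Rightarrow> chi Z w x | None \<Rightarrow> None))"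

text \<open>The machine in which the transition \<open>psi Z q x\<close> takes place.\<close>

partial_function (option) acting :: "('q, 'x) himm \<Rightarrow> 'q \<Rightarrow> 'x \<Rightarrow> ('q, 'x, real) mm option" where
  "acting Z q x =
     (case delta (owner Z q) q x of
        Some v \<Rightarrow> Some (owner Z q)
      | None \<Rightarrow> (case parent_state Z (owner Z q) of Some w \<Rightarrow> acting Z w x | None \<Rightarrow> None))"


section \<open>Optimal exit costs\<close>

definition trajectory :: "('q, 'x) himm \<Rightarrow> ('q \<times> 'x) list \<Rightarrow> bool" where
  "trajectory Z \<tau> \<longleftrightarrow>
     set \<tau> \<subseteq> leaf_states Z \<times> all_inputs Z \<and>
     (\<forall>i. Suc i < length \<tau> \<longrightarrow> psi Z (fst (\<tau> ! i)) (snd (\<tau> ! i)) = Some (fst (\<tau> ! Suc i)))"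

definition subtree :: "('q, 'x) himm \<Rightarrow> ('q, 'x, real) mm \<Rightarrow> ('q, 'x, real) mm set" where
  "subtree Z M = {N. (M, N) \<in> (edges Z)\<^sup>*}"

definition contained :: "('q, 'x) himm \<Rightarrow> ('q, 'x, real) mm \<Rightarrow> 'q \<Rightarrow> bool" where
  "contained Z M q \<longleftrightarrow> q \<in> leaf_states Z \<and> (\<exists>N\<in>subtree Z M. q \<in> states N)"

text \<open>
  Two readings of ``the transition with input \<open>x\<close> from \<open>q\<close> exits \<open>M\<close>''. Under \<open>exits_target\<close>
  the target state \<open>\<psi>(q,x)\<close> is not contained in \<open>M\<close>; under \<open>exits_subtree\<close> the transition does
  not happen inside the subtree with root \<open>M\<close>. They differ exactly for transitions that are
  passed up to a proper ancestor of \<open>M\<close> which sends them straight back into \<open>M\<close>, for example via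
  a self-loop at the state refined by \<open>M\<close>. In that case no \<open>(M,x)\<close>-exit trajectory exists under
  \<open>exits_target\<close>, although \<open>M\<close> is left (and entered again) with input \<open>x\<close>.
\<close>

definition exits_target :: "('q, 'x) himm \<Rightarrow> ('q, 'x, real) mm \<Rightarrow> 'q \<Rightarrow> 'x \<Rightarrow> bool" where
  "exits_target Z M q x \<longleftrightarrow> \<not> (\<exists>v. psi Z q x = Some v \<and> contained Z M v)"

definition exits_subtree :: "('q, 'x) himm \<Rightarrow> ('q, 'x, real) mm \<Rightarrow> 'q \<Rightarrow> 'x \<Rightarrow> bool" where
  "exits_subtree Z M q x \<longleftrightarrow> \<not> (\<exists>N. acting Z q x = Some N \<and> N \<in> subtree Z M)"

definition reenters :: "('q, 'x) himm \<Rightarrow> ('q, 'x, real) mm \<Rightarrow> 'x \<Rightarrow> bool" where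
  "reenters Z M x \<longleftrightarrow>
     (\<exists>w v. parent_state Z M = Some w \<and> psi Z w x = Some v \<and> contained Z M v)"

text \<open>The parameter \<open>E\<close> is one of the two exit conditions above.\<close>

definition exit_trajectory ::
  "(('q, 'x) himm \<Rightarrow> ('q, 'x, real) mm \<Rightarrow> 'q \<Rightarrow> 'x \<Rightarrow> bool) \<Rightarrow>
   ('q, 'x) himm \<Rightarrow> ('q, 'x, real) mm \<Rightarrow> 'x \<Rightarrow> ('q \<times> 'x) list \<Rightarrow> bool" where
  "exit_trajectory E Z M x \<tau> \<longleftrightarrow>
     trajectory Z \<tau> \<and> \<tau> \<noteq> [] \<and> fst (hd \<tau>) = start Z M \<and>
     (\<forall>(q, y)\<in>set \<tau>. contained Z M q) \<and>
     E Z M (fst (last \<tau>)) (snd (last \<tau>)) \<and> snd (last \<tau>) = x"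

definition exit_cost :: "('q, 'x) himm \<Rightarrow> ('q \<times> 'x) list \<Rightarrow> real" where
  "exit_cost Z \<tau> = (\<Sum>i<length \<tau> - 1. the (chi Z (fst (\<tau> ! i)) (snd (\<tau> ! i))))"

text \<open>\<open>c\<close> is the minimum of the exit costs, to be read as \<open>\<infinity>\<close> if there is no exit trajectory.\<close>

definition is_optimal_exit_cost ::
  "(('q, 'x) himm \<Rightarrow> ('q, 'x, real) mm \<Rightarrow> 'q \<Rightarrow> 'x \<Rightarrow> bool) \<Rightarrow>
   ('q, 'x) himm \<Rightarrow> ('q, 'x, real) mm \<Rightarrow> 'x \<Rightarrow> ereal \<Rightarrow> bool" where
  "is_optimal_exit_cost E Z M x c \<longleftrightarrow>
     (if \<exists>\<tau>. exit_trajectory E Z M x \<tau>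
      then (\<exists>\<tau>. exit_trajectory E Z M x \<tau> \<and> c = ereal (exit_cost Z \<tau>)) \<and>
           (\<forall>\<tau>. exit_trajectory E Z M x \<tau> \<longrightarrow> c \<le> ereal (exit_cost Z \<tau>))
      else c = \<infinity>)"


section \<open>The algorithm\<close>

text \<open>
  Dijkstra's algorithm, with ties broken arbitrarily. A partial run assigns to each settled
  state its cost and a trajectory leading to it; as long as some arc leaves the settled states,
  one whose end has least tentative cost is chosen and that end is settled.
\<close>

inductive dijkstra_run ::
  "('q, 'x, ereal) mm \<Rightarrow> ('q \<Rightarrow> (ereal \<times> ('q \<times> 'x) list) option) \<Rightarrow> bool" for M where
  initial: "dijkstra_run M [init M \<mapsto> (0, [])]"
| settle: "dijkstra_run M (D(v \<mapsto> (c + gamma M u y, p @ [(u, y)])))"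
    if "dijkstra_run M D"
      and "D u = Some (c, p)" and "delta M u y = Some v" and "D v = None"
      and "\<forall>u' c' p' y' v'. D u' = Some (c', p') \<and> delta M u' y' = Some v' \<and> D v' = None
             \<longrightarrow> c + gamma M u y \<le> c' + gamma M u' y'"

definition dijkstra ::
  "('q, 'x, ereal) mm \<Rightarrow> ('q \<Rightarrow> (ereal \<times> ('q \<times> 'x) list) option) \<Rightarrow> bool" where
  "dijkstra M D \<longleftrightarrow>
     dijkstra_run M D \<and> (\<forall>u y v. D u \<noteq> None \<and> delta M u y = Some v \<longrightarrow> D v \<noteq> None)"

datatype ('q, 'x) aug_state = St 'q | Exit 'x

definition aug_gamma ::
  "('q, 'x, real) mm \<Rightarrow> ('q \<Rightarrow> 'x \<Rightarrow> ereal) \<Rightarrow> ('q, 'x) aug_state \<Rightarrow> 'x \<Rightarrow> ereal" where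
  "aug_gamma M c p y =
     (case p of
        St q \<Rightarrow> (if delta M q y \<noteq> None then c q y + ereal (gamma M q y) else c q y)
      | Exit x \<Rightarrow> 0)"

definition augmented ::
  "('q, 'x, real) mm \<Rightarrow> ('q \<Rightarrow> 'x \<Rightarrow> ereal) \<Rightarrow> (('q, 'x) aug_state, 'x, ereal) mm" where
  "augmented M c =
     \<lparr>states = St ` states M \<union> Exit ` inputs M,
      inputs = inputs M,
      outputs = (\<lambda>(p, y). aug_gamma M c p y) ` ((St ` states M \<union> Exit ` inputs M) \<times> inputs M),
      delta = (\<lambda>p y. case p of
          St q \<Rightarrow>
            if q \<in> states M \<and> y \<in> inputs M
            then (case delta M q y of Some v \<Rightarrow> Some (St v) | None \<Rightarrow> Some (Exit y))
            else None
        | Exit x \<Rightarrow> None),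
      gamma = aug_gamma M c,
      init = St (init M)\<rparr>"

text \<open>An exit result is the family \<open>(c\<^sub>x, z\<^sub>x)\<close>; there is no trajectory \<open>z\<^sub>x\<close> if \<open>E\<^sub>x\<close> is unreachable.\<close>

type_synonym ('q, 'x) exit_result =
  "'x \<Rightarrow> ereal \<times> (('q, 'x) aug_state \<times> 'x) list option"

definition read_exits ::
  "(('q, 'x) aug_state \<Rightarrow> (ereal \<times> (('q, 'x) aug_state \<times> 'x) list) option) \<Rightarrow>
   ('q, 'x) exit_result" where
  "read_exits D x = (case D (Exit x) of Some (c, z) \<Rightarrow> (c, Some z) | None \<Rightarrow> (\<infinity>, None))"

record ('q, 'x) memo =
  marked :: "('q, 'x, real) mm set"
  table :: "('q, 'x, real) mm \<Rightarrow> ('q, 'x) exit_result"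

text \<open>
  \<open>optimal_exit Z M \<sigma> r \<sigma>'\<close>: a call of \<open>Optimal_exit(M)\<close> in memory \<open>\<sigma>\<close> can return \<open>r\<close> and leave
  memory \<open>\<sigma>'\<close>. \<open>visit Z M qs \<sigma> c \<sigma>'\<close> is its loop, computing \<open>c\<^sup>q\<^sub>x\<close> for the states \<open>q\<close> in
  \<open>qs\<close>; the order in which the states of \<open>M\<close> are visited is arbitrary.
\<close>

inductive optimal_exit ::
    "('q, 'x) himm \<Rightarrow> ('q, 'x, real) mm \<Rightarrow> ('q, 'x) memo \<Rightarrow>
     ('q, 'x) exit_result \<Rightarrow> ('q, 'x) memo \<Rightarrow> bool"
  and visit ::
    "('q, 'x) himm \<Rightarrow> ('q, 'x, real) mm \<Rightarrow> 'q list \<Rightarrow> ('q, 'x) memo \<Rightarrow>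
     ('q \<Rightarrow> 'x \<Rightarrow> ereal) \<Rightarrow> ('q, 'x) memo \<Rightarrow> bool"
  for Z where
  unmarked: "optimal_exit Z M \<sigma> (table \<sigma> M) \<sigma>"
    if "M \<notin> marked \<sigma>"
| marked: "optimal_exit Z M \<sigma> r (\<sigma>'\<lparr>marked := marked \<sigma>' - {M}, table := (table \<sigma>')(M := r)\<rparr>)"
    if "M \<in> marked \<sigma>"
      and "distinct qs" and "set qs = states M" and "visit Z M qs \<sigma> c \<sigma>'"
      and "dijkstra (augmented M c) D" and "r = read_exits D"
| visit_nil: "visit Z M [] \<sigma> (\<lambda>q x. 0) \<sigma>"
| visit_leaf: "visit Z M (q # qs) \<sigma> (c(q := (\<lambda>x. 0))) \<sigma>'"
    if "child Z M q = None" and "visit Z M qs \<sigma> c \<sigma>'"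
| visit_child: "visit Z M (q # qs) \<sigma> (c(q := (\<lambda>x. fst (r x)))) \<sigma>''"
    if "child Z M q = Some N" and "optimal_exit Z N \<sigma> r \<sigma>'" and "visit Z M qs \<sigma>' c \<sigma>''"

definition compute_optimal_exits ::
  "('q, 'x) himm \<Rightarrow> ('q, 'x) memo \<Rightarrow> ('q, 'x) exit_result \<Rightarrow> ('q, 'x) memo \<Rightarrow> bool" where
  "compute_optimal_exits Z \<sigma> r \<sigma>' \<longleftrightarrow> optimal_exit Z (root_mm Z) \<sigma> r \<sigma>'"


section \<open>Modifications and marking\<close>

definition replace_mm ::
  "('q, 'x) himm \<Rightarrow> ('q, 'x, real) mm \<Rightarrow> ('q, 'x, real) mm \<Rightarrow> ('q, 'x) himm" where
  "replace_mm Z M M' =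
     (let \<rho> = (\<lambda>N. if N = M then M' else N) in
      \<lparr>machines = \<rho> ` machines Z,
       child = (\<lambda>W q. if W \<in> \<rho> ` machines Z
                      then map_option \<rho> (child Z (if W = M' then M else W) q) else None)\<rparr>)"

definition join :: "('q, 'x) himm \<Rightarrow> ('q, 'x) himm \<Rightarrow> ('q, 'x) himm" where
  "join Z Z' =
     \<lparr>machines = machines Z \<union> machines Z',
      child = (\<lambda>W q. if W \<in> machines Z' then child Z' W q else child Z W q)\<rparr>"

definition connect ::
  "('q, 'x) himm \<Rightarrow> ('q, 'x, real) mm \<Rightarrow> 'q \<Rightarrow> ('q, 'x) himm \<Rightarrow> ('q, 'x) himm" where
  "connect Z M q Z' =
     (join Z Z')\<lparr>child := (child (join Z Z'))(M := (child (join Z Z') M)(q \<mapsto> root_mm Z'))\<rparr>"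

text \<open>The new state has no outgoing transitions; \<open>g\<close> is its (immaterial) output row.\<close>

definition mm_add_state :: "('q, 'x, real) mm \<Rightarrow> 'q \<Rightarrow> ('x \<Rightarrow> real) \<Rightarrow> ('q, 'x, real) mm" where
  "mm_add_state M q g = M\<lparr>states := insert q (states M), gamma := (gamma M)(q := g)\<rparr>"

text \<open>Transitions leading to the removed state become undefined.\<close>

definition mm_remove_state :: "('q, 'x, real) mm \<Rightarrow> 'q \<Rightarrow> ('q, 'x, real) mm" where
  "mm_remove_state M q =
     M\<lparr>states := states M - {q},
       delta := (\<lambda>p y. if p = q \<or> delta M p y = Some q then None else delta M p y)\<rparr>"

text \<open>Removing the \<open>q\<close>-arc of \<open>M\<close> also removes the subtree it leads to.\<close>

definition prune :: "('q, 'x) himm \<Rightarrow> ('q, 'x, real) mm \<Rightarrow> 'q \<Rightarrow> ('q, 'x) himm" where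
  "prune Z M q =
     (let D = (case child Z M q of Some N \<Rightarrow> subtree Z N | None \<Rightarrow> {}) in
      \<lparr>machines = machines Z - D,
       child = (\<lambda>W p. if W \<in> D \<or> (W = M \<and> p = q) then None else child Z W p)\<rparr>)"

definition compose ::
  "('q, 'x, real) mm \<Rightarrow> 'q list \<Rightarrow> ('q, 'x) himm list \<Rightarrow> ('q, 'x) himm" where
  "compose M qs Zs =
     foldr (\<lambda>Z' Z. join Z Z') Zs
       \<lparr>machines = {M},
        child = (\<lambda>W q. if W = M then map_of (zip qs (map root_mm Zs)) q else None)\<rparr>"

definition merge_memo ::
  "('q, 'x) memo \<Rightarrow> ('q, 'x) himm \<Rightarrow> ('q, 'x) memo \<Rightarrow> ('q, 'x) memo" where
  "merge_memo \<sigma> Z' \<sigma>' =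
     \<lparr>marked = marked \<sigma> \<union> marked \<sigma>',
      table = (\<lambda>N. if N \<in> machines Z' then table \<sigma>' N else table \<sigma> N)\<rparr>"

text \<open>
  The procedure \<open>Mark\<close>, for modifications other than compositions: \<open>Z\<close> is the modified hierarchy
  and \<open>M\<close> the machine concerned. Marks of machines no longer present in \<open>Z\<close> are discarded.
\<close>

definition mark ::
  "('q, 'x) himm \<Rightarrow> ('q, 'x, real) mm \<Rightarrow> ('q, 'x) memo \<Rightarrow> ('q, 'x) memo" where
  "mark Z M \<sigma> =
     \<sigma>\<lparr>marked := (marked \<sigma> \<inter> machines Z) \<union> {M} \<union> {W. (W, M) \<in> (edges Z)\<^sup>+}\<rparr>"

text \<open>
  \<open>marked_himm Z \<sigma>\<close>: the hierarchy \<open>Z\<close> together with its marks and computed results \<open>\<sigma>\<close> is obtained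
  by initialisation and a sequence of modifications, each followed by \<open>Mark\<close>, with calls of
  the algorithm in between.
\<close>

inductive marked_himm :: "('q, 'x) himm \<Rightarrow> ('q, 'x) memo \<Rightarrow> bool" where
  initialise: "marked_himm Z \<lparr>marked = machines Z, table = t\<rparr>"
    if "is_himm Z"
| compute: "marked_himm Z \<sigma>'"
    if "marked_himm Z \<sigma>" and "compute_optimal_exits Z \<sigma> r \<sigma>'"
| add_himm: "marked_himm Z' (mark Z' M' (merge_memo \<sigma> Zadd \<sigma>add))"
    if "marked_himm Z \<sigma>" and "marked_himm Zadd \<sigma>add" and "M \<in> machines Z"
      and "\<forall>N\<in>machines Zadd. inputs N = inputs M \<and> outputs N = outputs M"
      and "all_states Z \<inter> all_states Zadd = {}"
      and "q \<notin> all_states Z \<union> all_states Zadd"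
      and "\<forall>y\<in>inputs M. g y \<in> outputs M"
      and "M' = mm_add_state M q g"
      and "Z' = connect (replace_mm Z M M') M' q Zadd"
| add_state: "marked_himm Z' (mark Z' M' \<sigma>)"
    if "marked_himm Z \<sigma>" and "M \<in> machines Z"
      and "q \<notin> all_states Z"
      and "\<forall>y\<in>inputs M. g y \<in> outputs M"
      and "M' = mm_add_state M q g"
      and "Z' = replace_mm Z M M'"
| subtract_state: "marked_himm Z' (mark Z' M' \<sigma>)"
    if "marked_himm Z \<sigma>" and "M \<in> machines Z"
      and "q \<in> states M" and "q \<noteq> init M"
      and "M' = mm_remove_state M q"
      and "Z' = replace_mm (prune Z M q) M M'"
| modify_arcs: "marked_himm Z' (mark Z' M' \<sigma>)"
    if "marked_himm Z \<sigma>" and "M \<in> machines Z"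
      and "M' = M\<lparr>delta := d, gamma := g, init := s\<rparr>" and "is_mm M'"
      and "Z' = replace_mm Z M M'"
| composition: "marked_himm (compose M qs (map fst Hs))
      (foldr (\<lambda>(Z, \<sigma>) \<sigma>'. merge_memo \<sigma>' Z \<sigma>) Hs \<lparr>marked = {M}, table = t\<rparr>)"
    if "\<And>Z \<sigma>. (Z, \<sigma>) \<in> set Hs \<Longrightarrow> marked_himm Z \<sigma>"
      and "is_mm M" and "distinct qs" and "set qs = states M" and "length Hs \<le> length qs"
      and "\<forall>(Z, \<sigma>)\<in>set Hs. \<forall>N\<in>machines Z. inputs N = inputs M \<and> outputs N = outputs M"
      and "\<forall>(Z, \<sigma>)\<in>set Hs. all_states Z \<inter> states M = {}"
      and "\<forall>i<length Hs. \<forall>j<i. all_states (fst (Hs ! i)) \<inter> all_states (fst (Hs ! j)) = {}"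

end

theory Submission
  imports Defs
begin

text \<open>
  The invariant behind the marking procedure is local: an unmarked machine has only unmarked
  children, and its stored result is the outcome of Dijkstra's algorithm on its augmented machine,
  with the costs of the refined states read from the stored results of the children. A modification
  changes the refinements of the modified machine and of its parent only, and both are marked
  afterwards; a run of the algorithm ends with no marks at all.

  For a hierarchy without marks, induction from the leaves of the tree upwards identifies the stored
  costs with optimal exit costs. A path in the augmented machine of \<open>M\<close> expands to a path of the
  hierarchy by replacing a visit of a refined state by an optimal exit path of its child; conversely
  a path below \<open>M\<close> splits at its visits of children, each costing at least the child's stored
  value. A path which leaves \<open>M\<close> and comes back comes back at the start of \<open>M\<close>, hence dropping
  everything before the last return only makes it cheaper.
\<close>

section \<open>Trees of machines\<close>

text \<open>The invariant speaks of outcomes of Dijkstra's algorithm and not of optimal exit costs,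
  because only the former are visibly local: they involve a machine, its arcs and the stored results
  of its children, whereas \<open>start\<close>, \<open>psi\<close> and trajectories range over the
  tree. So modifications are treated without any trajectory, and exit costs are analysed once, for
  the mark-free hierarchy left by a run. The charge \<open>c q y + gamma M q y\<close> is justified
  by a memoryless exit: once a transition climbs out of a child, its effect depends on the child and
  the input, not on the state that was left. Hence a visit of a refined state matters only through
  its exit input and its cost. The obstacle is that an exit trajectory restricts its states but not
  the machines where its transitions take place. \<open>flat_path\<close> follows trajectories,
  \<open>inner_path\<close> is what augmented machines can see, and nonnegative outputs are used to
  pass from one to the other as well as for Dijkstra's algorithm. An impossible exit costs
  \<infinity>, so augmented machines may have arcs of infinite cost; walks over them correspond to
  no path, and only finite values are claimed to be attained.\<close>

lemma is_mmD:
  assumes "is_mm M"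
  shows "finite (states M)" "finite (inputs M)" "init M \<in> states M"
    and "\<And>q y v. delta M q y = Some v \<Longrightarrow> q \<in> states M \<and> y \<in> inputs M \<and> v \<in> states M"
    and "\<And>q y. q \<in> states M \<Longrightarrow> y \<in> inputs M \<Longrightarrow> gamma M q y \<in> outputs M"
    and "\<And>q y. q \<in> states M \<Longrightarrow> y \<in> inputs M \<Longrightarrow> 0 \<le> gamma M q y"
  using assms unfolding is_mm_def by (blast, blast, blast, blast, blast, force)

locale hierarchy =
  fixes Z :: "('q, 'x) himm"
  assumes himm: "is_himm Z"
begin

lemma finite_machines: "finite (machines Z)"
  and machine_is_mm: "M \<in> machines Z \<Longrightarrow> is_mm M"
  and same_inputs: "M \<in> machines Z \<Longrightarrow> N \<in> machines Z \<Longrightarrow> inputs M = inputs N"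
  and same_outputs: "M \<in> machines Z \<Longrightarrow> N \<in> machines Z \<Longrightarrow> outputs M = outputs N"
  and disjoint_states: "M \<in> machines Z \<Longrightarrow> N \<in> machines Z \<Longrightarrow> M \<noteq> N \<Longrightarrow> states M \<inter> states N = {}"
  and tree: "is_tree Z"
  using himm unfolding is_himm_def by blast+

lemma childD:
  assumes "child Z M q = Some N"
  shows "M \<in> machines Z" "q \<in> states M" "N \<in> machines Z" "(M, N) \<in> edges Z"
  using assms tree unfolding is_tree_def edges_def by blast+

lemma child_inj: "child Z M q = Some N \<Longrightarrow> child Z M' q' = Some N \<Longrightarrow> M = M' \<and> q = q'"
  using tree unfolding is_tree_def by blast

lemma edge_machines: "(M, N) \<in> edges Z \<Longrightarrow> M \<in> machines Z \<and> N \<in> machines Z"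
  unfolding edges_def using childD by blast

lemma edge_parent_unique: "(A, N) \<in> edges Z \<Longrightarrow> (B, N) \<in> edges Z \<Longrightarrow> A = B"
  unfolding edges_def using child_inj by blast

lemma machine_unique:
  "M \<in> machines Z \<Longrightarrow> N \<in> machines Z \<Longrightarrow> q \<in> states M \<Longrightarrow> q \<in> states N \<Longrightarrow> M = N"
  using disjoint_states by blast

lemma owner_eq: "M \<in> machines Z \<Longrightarrow> q \<in> states M \<Longrightarrow> owner Z q = M"
  unfolding owner_def using machine_unique by blast

lemma deltaD:
  assumes "M \<in> machines Z" "delta M q y = Some v"
  shows "q \<in> states M" "y \<in> inputs M" "v \<in> states M"
  using is_mmD(4)[OF machine_is_mm[OF assms(1)] assms(2)] by simp_all

lemma all_inputs_eq: "M \<in> machines Z \<Longrightarrow> all_inputs Z = inputs M"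
  unfolding all_inputs_def using same_inputs by blast

text \<open>The description in \<open>root_mm\<close> is well defined: a second root would be
  reachable from the first, and a path ending in a machine without incoming arc is empty.\<close>

lemma root_mm_root: "is_root Z (root_mm Z)"
  and root_mm_reaches: "N \<in> machines Z \<Longrightarrow> (root_mm Z, N) \<in> (edges Z)\<^sup>*"
proof -
  obtain R where R: "is_root Z R" "\<forall>N\<in>machines Z. (R, N) \<in> (edges Z)\<^sup>*"
    using tree unfolding is_tree_def by blast
  have "R' = R" if "is_root Z R'" for R'
  proof -
    have "(R, R') \<in> (edges Z)\<^sup>*"
      using that R unfolding is_root_def by blast
    then show ?thesis
      using that unfolding is_root_def edges_def by (auto elim: rtranclE)
  qed
  with R have "root_mm Z = R"
    unfolding root_mm_def by blast
  with R show "is_root Z (root_mm Z)" "N \<in> machines Z \<Longrightarrow> (root_mm Z, N) \<in> (edges Z)\<^sup>*"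
    by auto
qed

lemma root_mm_machine: "root_mm Z \<in> machines Z"
  using root_mm_root unfolding is_root_def by blast

lemma not_edge_root: "(M, root_mm Z) \<notin> edges Z"
  using root_mm_root unfolding is_root_def edges_def by blast

text \<open>\<open>is_tree\<close> does not mention cycles. The root lies on none because nothing
  points to it, and as parents are unique, a cycle through \<open>K\<close> also runs through the
  parent of \<open>K\<close>; so the absence of cycles is passed down the path from the
  root.\<close>

lemma acyclic_edges: "(M, M) \<notin> (edges Z)\<^sup>+"
proof
  assume M: "(M, M) \<in> (edges Z)\<^sup>+"
  then have "M \<in> machines Z"
    using edge_machines by (blast dest: tranclD)
  then have "(root_mm Z, M) \<in> (edges Z)\<^sup>*"
    by (rule root_mm_reaches)
  then have "(M, M) \<notin> (edges Z)\<^sup>+"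
  proof induction
    case base
    show ?case
      using not_edge_root by (blast dest: tranclD2)
  next
    case (step N K)
    show ?case
    proof
      assume "(K, K) \<in> (edges Z)\<^sup>+"
      then obtain P where "(K, P) \<in> (edges Z)\<^sup>*" "(P, K) \<in> edges Z"
        by (blast dest: tranclD2)
      with step.hyps(2) have "(N, N) \<in> (edges Z)\<^sup>+"
        using edge_parent_unique by (metis rtrancl_into_trancl2)
      with step.IH show False ..
    qed
  qed
  with M show False
    by contradiction
qed

lemma wf_children: "wf ((edges Z)\<inverse>)"
proof (rule finite_acyclic_wf_converse)
  have "edges Z \<subseteq> machines Z \<times> machines Z"
    using edge_machines by auto
  then show "finite (edges Z)"
    using finite_machines by (meson finite_SigmaI finite_subset)
  show "acyclic (edges Z)"
    using acyclic_edges by (simp add: acyclic_def)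
qed

lemma tree_induct [case_names machine]:
  assumes "\<And>M. (\<And>N. (M, N) \<in> edges Z \<Longrightarrow> P N) \<Longrightarrow> P M"
  shows "P M"
  using wf_children by (induction M rule: wf_induct_rule) (use assms in auto)

text \<open>Unique parents make the ancestors of a machine a chain. This is applied when the machine
  owning some state is found to lie in two subtrees.\<close>

lemma ancestors_chain:
  assumes "(A, K) \<in> (edges Z)\<^sup>*" "(B, K) \<in> (edges Z)\<^sup>*"
  shows "(A, B) \<in> (edges Z)\<^sup>* \<or> (B, A) \<in> (edges Z)\<^sup>*"
  using assms
proof (induction arbitrary: B)
  case (step K' K)
  show ?case
  proof (cases "B = K")
    case True
    then show ?thesis
      using step.hyps by (auto intro: rtrancl_into_rtrancl)
  next
    case False
    then have "(B, K') \<in> (edges Z)\<^sup>*"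
      using step.prems step.hyps(2) edge_parent_unique by (metis rtranclE)
    then show ?thesis
      by (rule step.IH)
  qed
qed auto

section \<open>Subtrees, contained states and the descent to a start state\<close>

lemma subtree_refl [simp]: "M \<in> subtree Z M"
  by (simp add: subtree_def)

lemma subtree_trans: "N \<in> subtree Z M \<Longrightarrow> K \<in> subtree Z N \<Longrightarrow> K \<in> subtree Z M"
  by (auto simp: subtree_def)

lemma subtree_child: "child Z M q = Some N \<Longrightarrow> N \<in> subtree Z M"
  using childD by (auto simp: subtree_def)

lemma subtree_machines: "N \<in> subtree Z M \<Longrightarrow> M \<in> machines Z \<Longrightarrow> N \<in> machines Z"
  unfolding subtree_def using edge_machines by (auto elim: rtranclE)

lemma parent_state_Some: "child Z W w = Some M \<Longrightarrow> parent_state Z M = Some w"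
  unfolding parent_state_def using child_inj by auto

lemma parent_state_SomeD: "parent_state Z M = Some w \<Longrightarrow> \<exists>W. child Z W w = Some M"
  by (metis option.distinct(1) option.inject parent_state_Some parent_state_def)

text \<open>Common core of \<open>start\<close> and \<open>psi\<close>: both pick a state of
  \<open>M\<close> and then descend through start states as long as it is refined.\<close>

definition entry :: "('q, 'x, real) mm \<Rightarrow> 'q \<Rightarrow> 'q" where
  "entry M v = (case child Z M v of Some N \<Rightarrow> start Z N | None \<Rightarrow> v)"

lemma start_eq: "start Z M = entry M (init M)"
  unfolding entry_def by (subst start.simps) (simp split: option.split)

lemma containedI: "K \<in> subtree Z M \<Longrightarrow> M \<in> machines Z \<Longrightarrow> q \<in> states K \<Longrightarrow> child Z K q = None \<Longrightarrow> contained Z M q"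
  unfolding contained_def leaf_states_def using subtree_machines by blast

lemma containedD:
  assumes "contained Z M q" "M \<in> machines Z"
  obtains K where "K \<in> subtree Z M" "K \<in> machines Z" "q \<in> states K" "child Z K q = None" "owner Z q = K"
proof -
  from assms obtain K L where "K \<in> subtree Z M" "q \<in> states K" "L \<in> machines Z" "q \<in> states L" "child Z L q = None"
    unfolding contained_def leaf_states_def by blast
  then show thesis
    using that assms(2) owner_eq subtree_machines machine_unique by metis
qed

lemma contained_subtree: "contained Z N q \<Longrightarrow> N \<in> subtree Z M \<Longrightarrow> contained Z M q"
  unfolding contained_def using subtree_trans by blast

lemma entry_contained:
  assumes "M \<in> machines Z" "v \<in> states M"
  shows "contained Z M (entry M v)"
  using assms
proof (induction M arbitrary: v rule: tree_induct)
  case (machine M)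
  show ?case
  proof (cases "child Z M v")
    case None
    then show ?thesis
      using machine.prems containedI[OF subtree_refl] by (simp add: entry_def)
  next
    case (Some N)
    then have "contained Z N (entry N (init N))"
      using machine.IH childD is_mmD(3) machine_is_mm by metis
    then show ?thesis
      using Some subtree_child contained_subtree by (auto simp: entry_def start_eq)
  qed
qed

lemma start_contained: "M \<in> machines Z \<Longrightarrow> contained Z M (start Z M)"
  unfolding start_eq using entry_contained is_mmD(3) machine_is_mm by blast

text \<open>A descent that ends below \<open>M\<close> must pass through \<open>M\<close>, and from
  there on it is the descent of \<open>M\<close> itself.\<close>

lemma start_through:
  assumes "Y \<in> machines Z" "M \<in> subtree Z Y" "contained Z M (start Z Y)"
  shows "start Z Y = start Z M"
  using assms
proof (induction Y rule: tree_induct)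
  case (machine Y)
  show ?case
  proof (cases "M = Y")
    case False
    then obtain N where N: "(Y, N) \<in> edges Z" "M \<in> subtree Z N"
      using machine.prems(2) unfolding subtree_def by (auto elim: converse_rtranclE)
    obtain K where K: "K \<in> subtree Z M" "start Z Y \<in> states K" "K \<in> machines Z" "owner Z (start Z Y) = K"
      using containedD machine.prems N by (metis edge_machines subtree_machines)
    \<comment> \<open>The descent takes the arc towards \<open>M\<close>. Stopping at once would
      place \<open>Y\<close> below its own child \<open>N\<close>; taking another child
      \<open>N'\<close> would place \<open>K\<close> below both \<open>N\<close> and
      \<open>N'\<close>, which cannot be comparable when they are distinct children of
      \<open>Y\<close>.\<close>
    have "child Z Y (init Y) = Some N"
    proof (cases "child Z Y (init Y)")
      case None
      then have "start Z Y = init Y"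
        by (simp add: start_eq entry_def)
      then have "K = Y"
        using K machine.prems(1) is_mmD(3) machine_is_mm machine_unique by metis
      then have "(Y, Y) \<in> (edges Z)\<^sup>+"
        using K(1) N unfolding subtree_def by (auto intro: rtrancl_into_trancl2)
      with acyclic_edges show ?thesis
        by blast
    next
      case (Some N')
      then have "start Z Y = start Z N'" and N': "(Y, N') \<in> edges Z" "N' \<in> machines Z"
        using childD by (simp_all add: start_eq entry_def)
      then have "K \<in> subtree Z N'"
        using start_contained containedD K by metis
      then have "(N, N') \<in> (edges Z)\<^sup>* \<or> (N', N) \<in> (edges Z)\<^sup>*"
        using K N ancestors_chain unfolding subtree_def by (blast intro: rtrancl_trans)
      then have "N = N'"
        using N(1) N'(1) acyclic_edges edge_parent_unique
        by (metis rtrancl.cases rtrancl_into_trancl2)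
      with Some show ?thesis
        by simp
    qed
    then have "start Z Y = start Z N"
      by (simp add: start_eq entry_def)
    then show ?thesis
      using machine.IH[OF N(1)] N machine.prems(3) edge_machines by metis
  qed simp
qed

section \<open>The machine in which a transition takes place\<close>

lemma step_here:
  assumes "M \<in> machines Z" "delta M q y = Some v"
  shows "acting Z q y = Some M" "psi Z q y = Some (entry M v)" "chi Z q y = Some (gamma M q y)"
proof -
  have "owner Z q = M"
    using owner_eq[OF assms(1) deltaD(1)[OF assms]] .
  then show "acting Z q y = Some M" "psi Z q y = Some (entry M v)" "chi Z q y = Some (gamma M q y)"
    unfolding acting.simps[of Z q y] psi.simps[of Z q y] chi.simps[of Z q y] entry_def
    by (simp_all only: assms(2) option.case split: option.split) auto
qed

text \<open>One notion for \<open>acting\<close>, \<open>psi\<close> and \<open>chi\<close>, which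
  all hand an undefined transition to the parent state. No state of \<open>M\<close> occurs in it:
  what happens after \<open>M\<close> is left depends on \<open>M\<close> and the input
  only.\<close>

definition climb :: "('q \<Rightarrow> 'x \<Rightarrow> 'a option) \<Rightarrow> ('q, 'x, real) mm \<Rightarrow> 'x \<Rightarrow> 'a option" where
  "climb f M y = (case parent_state Z M of Some w \<Rightarrow> f w y | None \<Rightarrow> None)"

lemma step_up:
  assumes "M \<in> machines Z" "q \<in> states M" "delta M q y = None"
  shows "acting Z q y = climb (acting Z) M y" "psi Z q y = climb (psi Z) M y" "chi Z q y = climb (chi Z) M y"
proof -
  have "owner Z q = M"
    using assms owner_eq by blast
  then show "acting Z q y = climb (acting Z) M y" "psi Z q y = climb (psi Z) M y" "chi Z q y = climb (chi Z) M y"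
    unfolding acting.simps[of Z q y] psi.simps[of Z q y] chi.simps[of Z q y] climb_def
    by (simp_all only: assms(3) option.case)
qed

lemma climb_child: "child Z W w = Some M \<Longrightarrow> climb f M y = f w y"
  by (simp add: climb_def parent_state_Some)

text \<open>The recursion climbs to the root, so the induction runs along the path from the root
  down to \<open>M\<close>. At the root itself an undefined transition has nowhere to go.\<close>

lemma acting_ancestor:
  assumes "M \<in> machines Z" "q \<in> states M" "acting Z q y = Some A"
  shows "(A, M) \<in> (edges Z)\<^sup>*" "A \<in> machines Z" "\<exists>p v. delta A p y = Some v \<and> psi Z q y = Some (entry A v)
    \<and> chi Z q y = Some (gamma A p y)"
proof -
  have "(root_mm Z, M) \<in> (edges Z)\<^sup>*"
    using assms root_mm_reaches by blast
  then have "(A, M) \<in> (edges Z)\<^sup>* \<and> A \<in> machines Z \<and> (\<exists>p v. delta A p y = Some v \<and> psi Z q y = Some (entry A v)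
    \<and> chi Z q y = Some (gamma A p y))"
    using assms
  proof (induction arbitrary: q)
    case base
    show ?case
    proof (cases "delta (root_mm Z) q y")
      case None
      then have "acting Z q y = None"
        using base step_up climb_def parent_state_SomeD childD not_edge_root
        by (metis option.case_eq_if option.collapse)
      with base show ?thesis
        by simp
    next
      case (Some v)
      then show ?thesis
        using step_here base by fastforce
    qed
  next
    case (step N M)
    show ?case
    proof (cases "delta M q y")
      case None
      obtain w where w: "child Z N w = Some M"
        using step.hyps unfolding edges_def by blast
      have eq: "acting Z q y = acting Z w y" "psi Z q y = psi Z w y" "chi Z q y = chi Z w y"
        using step_up[OF step.prems(1,2) None] climb_child[OF w] by simp_all
      then have "acting Z w y = Some A"
        using step.prems by simp
      then show ?thesis
        using step.IH[OF childD(1,2)[OF w]] step.hyps(2) unfolding eq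
        by (meson rtrancl_into_rtrancl)
    next
      case (Some v)
      then show ?thesis
        using step_here step.prems by fastforce
    qed
  qed
  then show "(A, M) \<in> (edges Z)\<^sup>*" "A \<in> machines Z" "\<exists>p v. delta A p y = Some v \<and> psi Z q y = Some (entry A v)
    \<and> chi Z q y = Some (gamma A p y)"
    by blast+
qed

text \<open>The machine acting on a climbing transition is the parent of \<open>M\<close> or above
  it; were it also below \<open>M\<close>, the tree would have a cycle.\<close>

lemma climb_acting_outside: "climb (acting Z) M y = Some A \<Longrightarrow> A \<notin> subtree Z M"
proof
  assume A: "climb (acting Z) M y = Some A" "A \<in> subtree Z M"
  then obtain W w where w: "child Z W w = Some M"
    unfolding climb_def using parent_state_SomeD by (auto split: option.splits)
  then have "acting Z w y = Some A"
    using A(1) by (simp add: climb_child[OF w])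
  then have "(A, W) \<in> (edges Z)\<^sup>*"
    using acting_ancestor(1) childD(1,2)[OF w] by blast
  then have "(M, M) \<in> (edges Z)\<^sup>+"
    using rtrancl_into_trancl1[OF rtrancl_trans childD(4)[OF w]] A(2) by (simp add: subtree_def)
  with acyclic_edges show False ..
qed

text \<open>The case split behind every later argument about leaving \<open>M\<close>. Within the
  path from \<open>M\<close> down to \<open>K\<close>, an undefined transition only moves to the
  parent, which is still below \<open>M\<close>, until \<open>M\<close> itself gives up. Case
  \<open>up\<close> includes transitions that are undefined altogether.\<close>

lemma inside_or_up:
  assumes "M \<in> machines Z" "K \<in> subtree Z M" "q \<in> states K"
  obtains (inside) A v d where "acting Z q y = Some A" "A \<in> subtree Z M" "psi Z q y = Some v"
      "contained Z M v" "chi Z q y = Some d"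
  | (up) "exits_subtree Z M q y" "acting Z q y = climb (acting Z) M y" "psi Z q y = climb (psi Z) M y"
      "chi Z q y = climb (chi Z) M y"
proof -
  have "(\<exists>A v d. acting Z q y = Some A \<and> A \<in> subtree Z M \<and> psi Z q y = Some v \<and>
      contained Z M v \<and> chi Z q y = Some d) \<or>
    acting Z q y = climb (acting Z) M y \<and> psi Z q y = climb (psi Z) M y \<and> chi Z q y = climb (chi Z) M y"
    using assms(2)[unfolded subtree_def mem_Collect_eq] assms(3)
  proof (induction arbitrary: q)
    case base
    show ?case
    proof (cases "delta M q y")
      case None
      then show ?thesis
        using step_up base assms(1) by blast
    next
      case (Some v)
      then have "v \<in> states M"
        using assms(1) by (simp add: deltaD)
      then show ?thesis
        using Some step_here[OF assms(1)] assms(1) entry_contained by fastforce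
    qed
  next
    case (step N K)
    then have K: "K \<in> machines Z" "K \<in> subtree Z M"
      using edge_machines unfolding subtree_def by (auto intro: rtrancl_into_rtrancl)
    show ?case
    proof (cases "delta K q y")
      case None
      obtain w where w: "child Z N w = Some K"
        using step.hyps unfolding edges_def by blast
      have eq: "acting Z q y = acting Z w y" "psi Z q y = psi Z w y" "chi Z q y = chi Z w y"
        using step_up[OF K(1) step.prems None] climb_child[OF w] by simp_all
      show ?thesis
        using step.IH[OF childD(2)[OF w]] unfolding eq by blast
    next
      case (Some v)
      then have "v \<in> states K"
        using K by (simp add: deltaD)
      then show ?thesis
        using Some step_here[OF K(1)] K entry_contained contained_subtree by metis
    qed
  qed
  then show thesis
  proof (elim disjE exE conjE)
    assume *: "acting Z q y = climb (acting Z) M y" "psi Z q y = climb (psi Z) M y"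
      "chi Z q y = climb (chi Z) M y"
    then have "exits_subtree Z M q y"
      using climb_acting_outside by (simp add: exits_subtree_def)
    then show thesis
      using * by (rule up)
  qed (rule inside)
qed

end

section \<open>Dijkstra's algorithm on augmented machines\<close>

text \<open>Costs of arbitrary walks from the initial state. The walks are not recorded, since
  correctness concerns the costs only.\<close>

inductive reach :: "('q, 'x, ereal) mm \<Rightarrow> 'q \<Rightarrow> ereal \<Rightarrow> bool" for M where
  reach_init: "reach M (init M) 0"
| reach_step: "reach M u c \<Longrightarrow> delta M u y = Some v \<Longrightarrow> reach M v (c + gamma M u y)"

definition nonneg_mm :: "('q, 'x, ereal) mm \<Rightarrow> bool" where
  "nonneg_mm M \<longleftrightarrow> (\<forall>u y v. delta M u y = Some v \<longrightarrow> 0 \<le> gamma M u y)"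

text \<open>The value \<infinity> needs no walk, so a state that is unreachable and one reachable
  only at infinite cost are treated alike.\<close>

definition least_cost :: "('q, 'x, ereal) mm \<Rightarrow> 'q \<Rightarrow> ereal \<Rightarrow> bool" where
  "least_cost M v c \<longleftrightarrow> (c = \<infinity> \<or> reach M v c) \<and> (\<forall>c'. reach M v c' \<longrightarrow> c \<le> c')"

lemma reach_nonneg: "reach M v c \<Longrightarrow> nonneg_mm M \<Longrightarrow> 0 \<le> c"
  by (induction rule: reach.induct) (auto simp: nonneg_mm_def)

lemma dijkstra_run_reach: "dijkstra_run M D \<Longrightarrow> D v = Some (c, p) \<Longrightarrow> reach M v c"
proof (induction arbitrary: v c p rule: dijkstra_run.induct)
  case initial
  then show ?case
    by (auto intro: reach_init split: if_splits)
next
  case (settle D u c' p' y v')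
  then show ?case
    by (auto intro: reach_step split: if_splits)
qed

lemma dijkstra_run_init: "dijkstra_run M D \<Longrightarrow> D (init M) \<noteq> None"
  by (induction rule: dijkstra_run.induct) auto

text \<open>A walk from the settled initial state to an unsettled state crosses the border of the
  settled set; what follows the crossing has nonnegative cost, so the walk up to and including it is
  no dearer than the whole.\<close>

lemma reach_leaves_settled:
  assumes "reach M v c" "D v = None" "D (init M) \<noteq> None" "nonneg_mm M"
  shows "\<exists>u c' y v'. D u \<noteq> None \<and> reach M u c' \<and> delta M u y = Some v' \<and> D v' = None \<and>
    c' + gamma M u y \<le> c"
  using assms
proof (induction rule: reach.induct)
  case (reach_step u c y v)
  show ?case
  proof (cases "D u")
    case None
    then obtain u' c' y' v' where *: "D u' \<noteq> None" "reach M u' c'" "delta M u' y' = Some v'"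
      "D v' = None" "c' + gamma M u' y' \<le> c"
      using reach_step.IH reach_step.prems by blast
    have "0 \<le> gamma M u y"
      using reach_step by (auto simp: nonneg_mm_def)
    with *(5) have "c' + gamma M u' y' \<le> c + gamma M u y"
      by (metis add.right_neutral add_mono)
    with * show ?thesis
      by blast
  next
    case (Some _)
    then show ?thesis
      using reach_step.hyps reach_step.prems by blast
  qed
qed simp

text \<open>Settled values never change, so only the newly settled state needs an argument: any walk
  to it contains an arc leaving the settled set, and the chosen arc is at most as expensive.\<close>

lemma dijkstra_run_least:
  assumes "dijkstra_run M D" "D v = Some (c, p)" "reach M v c'" "nonneg_mm M"
  shows "c \<le> c'"
  using assms
proof (induction arbitrary: v c p c' rule: dijkstra_run.induct)
  case initial
  then show ?case
    using reach_nonneg by (auto split: if_splits)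
next
  case (settle D u d r y w)
  show ?case
  proof (cases "v = w")
    case False
    then show ?thesis
      using settle by (auto split: if_splits)
  next
    case True
    then have c: "c = d + gamma M u y"
      using settle.prems by simp
    obtain u' e y' v' where *: "D u' \<noteq> None" "reach M u' e" "delta M u' y' = Some v'"
      "D v' = None" "e + gamma M u' y' \<le> c'"
      using reach_leaves_settled settle.prems(2,3) settle.hyps(1,4) dijkstra_run_init True by metis
    then obtain e' r' where e': "D u' = Some (e', r')"
      by auto
    \<comment> \<open>The greedy choice compares with the stored cost \<open>e'\<close> of
      \<open>u'\<close>; the induction hypothesis then replaces \<open>e'\<close> by the cost
      \<open>e\<close> of the competing walk.\<close>
    then have "c \<le> e' + gamma M u' y'"
      using settle.hyps(5) * c by blast
    also have "\<dots> \<le> e + gamma M u' y'"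
      using settle.IH[OF e' *(2) settle.prems(3)] by (rule add_right_mono)
    finally show ?thesis
      using *(5) by simp
  qed
qed

lemma dijkstra_reach_settled: "dijkstra M D \<Longrightarrow> reach M v c \<Longrightarrow> D v \<noteq> None"
proof -
  assume D: "dijkstra M D"
  show "reach M v c \<Longrightarrow> D v \<noteq> None"
    by (induction rule: reach.induct) (use D dijkstra_run_init in \<open>auto simp: dijkstra_def\<close>)
qed

lemma read_exits_least:
  assumes "dijkstra M D" "nonneg_mm M"
  shows "least_cost M (Exit x) (fst (read_exits D x))"
proof (cases "D (Exit x)")
  case None
  then show ?thesis
    using dijkstra_reach_settled[OF assms(1)] by (fastforce simp: read_exits_def least_cost_def)
next
  case (Some cz)
  then obtain c z where "D (Exit x) = Some (c, z)"
    by (cases cz) auto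
  then show ?thesis
    using assms dijkstra_run_reach dijkstra_run_least
    by (fastforce simp: read_exits_def least_cost_def dijkstra_def)
qed

text \<open>Each settlement shrinks the finite set of unsettled states, and as long as arcs lead out
  of the settled set, one of least tentative cost exists.\<close>

lemma dijkstra_exists:
  assumes "finite S" "finite X" "init M \<in> S"
    and closed: "\<And>u y v. delta M u y = Some v \<Longrightarrow> u \<in> S \<and> y \<in> X \<and> v \<in> S"
  shows "\<exists>D. dijkstra M D"
proof -
  have "\<exists>D'. dijkstra M D'" if "dijkstra_run M D" "dom D \<subseteq> S" for D
    using that
  proof (induction "card (S - dom D)" arbitrary: D rule: less_induct)
    case less
    \<comment> \<open>\<open>A\<close> consists of the arcs leaving the settled set, given by source
      and input, and \<open>w\<close> is their tentative cost.\<close>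
    define A where "A = {(u, y). \<exists>v. D u \<noteq> None \<and> delta M u y = Some v \<and> D v = None}"
    define w where "w = (\<lambda>(u, y). fst (the (D u)) + gamma M u y)"
    show ?case
    proof (cases "A = {}")
      case True
      then have "dijkstra M D"
        unfolding dijkstra_def
      proof (intro conjI allI impI notI; (elim conjE)?)
        fix u y v
        assume "D u \<noteq> None" "delta M u y = Some v" "D v = None"
        then have "(u, y) \<in> A"
          unfolding A_def by simp
        with True show False
          by simp
      qed (rule less.prems(1))
      then show ?thesis
        by blast
    next
      case False
      have "A \<subseteq> S \<times> X"
        using closed by (auto simp: A_def)
      then have "finite A"
        using assms by (meson finite_SigmaI finite_subset)
      then obtain a where a: "a \<in> A" "\<And>b. b \<in> A \<Longrightarrow> w a \<le> w b"
        using False by (metis arg_min_if_finite(1) arg_min_least)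
      obtain u y where uy: "a = (u, y)"
        by fastforce
      with a(1) obtain c p v where *: "D u = Some (c, p)" "delta M u y = Some v" "D v = None"
        unfolding A_def by auto
      define D' where "D' = D(v \<mapsto> (c + gamma M u y, p @ [(u, y)]))"
      have "\<forall>u' c' p' y' v'. D u' = Some (c', p') \<and> delta M u' y' = Some v' \<and> D v' = None
             \<longrightarrow> c + gamma M u y \<le> c' + gamma M u' y'"
      proof (intro allI impI; elim conjE)
        fix u' c' p' y' v'
        assume "D u' = Some (c', p')" "delta M u' y' = Some v'" "D v' = None"
        then show "c + gamma M u y \<le> c' + gamma M u' y'"
          using a(2)[of "(u', y')"] * by (auto simp: A_def w_def uy)
      qed
      with less.prems(1) * have "dijkstra_run M D'"
        unfolding D'_def by (intro dijkstra_run.settle)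
      moreover have "v \<in> S" "dom D' = insert v (dom D)" "v \<notin> dom D"
        using closed *(2,3) by (auto simp: D'_def)
      moreover from this have "card (S - dom D') < card (S - dom D)"
        using assms(1) by (intro psubset_card_mono) auto
      ultimately show ?thesis
        using less.hyps[of D'] less.prems(2) by simp
    qed
  qed
  from this[OF dijkstra_run.initial] assms(3) show ?thesis
    by simp
qed

section \<open>Augmented machines\<close>

lemma augmented_simps:
  "init (augmented M c) = St (init M)"
  "delta (augmented M c) (St q) y = Some (St v) \<longleftrightarrow> q \<in> states M \<and> y \<in> inputs M \<and> delta M q y = Some v"
  "delta (augmented M c) (St q) y = Some (Exit x) \<longleftrightarrow> q \<in> states M \<and> x \<in> inputs M \<and> y = x \<and> delta M q x = None"
  "delta (augmented M c) (Exit x) y = None"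
  "gamma (augmented M c) (St q) y = (if delta M q y \<noteq> None then c q y + ereal (gamma M q y) else c q y)"
  by (auto simp: augmented_def aug_gamma_def split: option.split)

lemma augmented_delta_cases:
  assumes "delta (augmented M c) p y = Some p'"
  obtains (move) q v where "p = St q" "p' = St v" "q \<in> states M" "y \<in> inputs M" "delta M q y = Some v"
  | (exit) q where "p = St q" "p' = Exit y" "q \<in> states M" "y \<in> inputs M" "delta M q y = None"
  using assms by (auto simp: augmented_def split: aug_state.splits if_splits option.splits)

lemma augmented_nonneg:
  assumes "is_mm M" "\<And>q y. q \<in> states M \<Longrightarrow> y \<in> inputs M \<Longrightarrow> 0 \<le> c q y"
  shows "nonneg_mm (augmented M c)"
  unfolding nonneg_mm_def
proof (intro allI impI)
  fix p y p'
  assume "delta (augmented M c) p y = Some p'"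
  then show "0 \<le> gamma (augmented M c) p y"
    using is_mmD(6)[OF assms(1)] assms(2) by (cases rule: augmented_delta_cases) (auto simp: augmented_simps)
qed

lemma augmented_dijkstra_exists:
  assumes "is_mm M"
  shows "\<exists>D. dijkstra (augmented M c) D"
proof (rule dijkstra_exists)
  show "finite (St ` states M \<union> Exit ` inputs M)" "finite (inputs M)"
    using is_mmD[OF assms] by auto
  show "init (augmented M c) \<in> St ` states M \<union> Exit ` inputs M"
    using is_mmD[OF assms] by (simp add: augmented_simps)
  fix p y p'
  assume "delta (augmented M c) p y = Some p'"
  then show "p \<in> St ` states M \<union> Exit ` inputs M \<and> y \<in> inputs M \<and> p' \<in> St ` states M \<union> Exit ` inputs M"
    by (cases rule: augmented_delta_cases) (auto dest: is_mmD(4)[OF assms])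
qed

section \<open>Paths below a machine\<close>

text \<open>The family \<open>c\<close> that the loop of the algorithm collects, here read off from
  exit costs \<open>C\<close> assigned to all machines.\<close>

definition child_cost ::
  "('q, 'x) himm \<Rightarrow> (('q, 'x, real) mm \<Rightarrow> 'x \<Rightarrow> ereal) \<Rightarrow> ('q, 'x, real) mm \<Rightarrow> 'q \<Rightarrow> 'x \<Rightarrow> ereal" where
  "child_cost Z C M q y = (case child Z M q of Some N \<Rightarrow> C N y | None \<Rightarrow> 0)"

context hierarchy
begin

lemma child_inputs: "child Z M q = Some N \<Longrightarrow> inputs N = inputs M"
  using childD(1,3) same_inputs by blast

text \<open>Every transition takes place below \<open>M\<close>. The cost covers completed
  transitions and the end is the state from which an exit may follow, so the uncharged last pair of
  an exit trajectory is left out from the beginning.\<close>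

inductive inner_path :: "('q, 'x, real) mm \<Rightarrow> 'q \<Rightarrow> real \<Rightarrow> bool" for M where
  inner_start: "inner_path M (start Z M) 0"
| inner_step: "inner_path M q' (c + d)"
    if "inner_path M q c" and "acting Z q y = Some A" and "A \<in> subtree Z M"
      and "psi Z q y = Some q'" and "chi Z q y = Some d"

text \<open>Unlike \<^const>\<open>inner_path\<close>, a flat path may leave the subtree of \<open>M\<close> and enter it again at once.\<close>

inductive flat_path :: "('q, 'x, real) mm \<Rightarrow> 'q \<Rightarrow> real \<Rightarrow> bool" for M where
  flat_start: "flat_path M (start Z M) 0"
| flat_step: "flat_path M q' (c + the (chi Z q y))"
    if "flat_path M q c" and "psi Z q y = Some q'" and "contained Z M q'"

lemma flat_contained: "flat_path M q c \<Longrightarrow> M \<in> machines Z \<Longrightarrow> contained Z M q"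
  by (induction rule: flat_path.induct) (auto intro: start_contained)

lemma inner_contained: "inner_path M q c \<Longrightarrow> M \<in> machines Z \<Longrightarrow> contained Z M q"
proof (induction rule: inner_path.induct)
  case (inner_step q c y A q' d)
  then obtain K where "K \<in> subtree Z M" "q \<in> states K"
    by (meson containedD)
  then show ?case
    using inside_or_up[of M K q y] inner_step exits_subtree_def by (metis option.inject)
qed (rule start_contained)

text \<open>Apply the inside-or-up split at the root: climbing above the root is undefined, so a
  defined transition is acted on by some machine of the tree.\<close>

lemma psi_SomeD:
  assumes "M \<in> machines Z" "q \<in> states M" "psi Z q y = Some v"
  obtains A p u d where "acting Z q y = Some A" "(A, M) \<in> (edges Z)\<^sup>*" "A \<in> machines Z"
    "delta A p y = Some u" "v = entry A u" "chi Z q y = Some d" "0 \<le> d"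
proof -
  have root: "root_mm Z \<in> machines Z" "M \<in> subtree Z (root_mm Z)"
    using root_mm_machine root_mm_reaches[OF assms(1)] by (simp_all add: subtree_def)
  have "parent_state Z (root_mm Z) = None"
    using parent_state_SomeD childD(4) not_edge_root by (metis not_None_eq)
  then have "climb (psi Z) (root_mm Z) y = None"
    by (simp add: climb_def)
  then obtain A where A: "acting Z q y = Some A"
    by (rule_tac inside_or_up[OF root assms(2), of y]) (use assms(3) in auto)
  then obtain p u where u: "delta A p y = Some u" "psi Z q y = Some (entry A u)"
    "chi Z q y = Some (gamma A p y)"
    using acting_ancestor(3) assms by blast
  have "A \<in> machines Z"
    using A acting_ancestor(2) assms by blast
  moreover from this have "0 \<le> gamma A p y"
    using is_mmD(6)[OF machine_is_mm] deltaD u by blast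
  ultimately show thesis
    using that A acting_ancestor(1) assms u by force
qed

text \<open>The acting machine \<open>A\<close> lies outside the subtree of \<open>M\<close>, so the
  subtree can only be entered by a descent through start states that begins at a child
  \<open>Y\<close> of \<open>A\<close>. If \<open>M\<close> lies below \<open>Y\<close>, this
  descent passes through \<open>M\<close>.\<close>

lemma reentry_at_start:
  assumes "M \<in> machines Z" "contained Z M q" "exits_subtree Z M q y"
    and "psi Z q y = Some v" "contained Z M v"
  shows "v = start Z M"
proof -
  obtain K where K: "K \<in> subtree Z M" "K \<in> machines Z" "q \<in> states K"
    using assms by (meson containedD)
  obtain A p u d where A: "acting Z q y = Some A" "A \<in> machines Z"
    "delta A p y = Some u" "v = entry A u"
    using psi_SomeD[OF K(2,3) assms(4)] by metis
  have out: "A \<notin> subtree Z M"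
    using A(1) assms(3) by (simp add: exits_subtree_def)
  obtain L where L: "L \<in> subtree Z M" "L \<in> machines Z" "v \<in> states L" "owner Z v = L"
    using assms(1,5) by (meson containedD)
  show ?thesis
  proof (cases "child Z A u")
    case None
    then have "v \<in> states A"
      using A deltaD by (simp add: entry_def)
    then have "L = A"
      using L A machine_unique by blast
    with L out show ?thesis
      by simp
  next
    case (Some Y)
    note Y = childD[OF Some]
    have v: "v = start Z Y"
      using A Some by (simp add: entry_def)
    then have "L \<in> subtree Z Y"
      using containedD[OF start_contained[OF Y(3)] Y(3)] L(4) by metis
    then have "(M, Y) \<in> (edges Z)\<^sup>* \<or> (Y, M) \<in> (edges Z)\<^sup>*"
      using L(1) ancestors_chain by (simp add: subtree_def)
    \<comment> \<open>If \<open>M\<close> were strictly above \<open>Y\<close>, it would be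
      \<open>A\<close> or above \<open>A\<close>, the parent of \<open>Y\<close>, contradicting that
      \<open>A\<close> is outside.\<close>
    then have "M \<in> subtree Z Y"
    proof
      assume "(M, Y) \<in> (edges Z)\<^sup>*"
      then show ?thesis
      proof (cases rule: rtranclE)
        case (step P)
        then have "P = A"
          using Y(4) edge_parent_unique by blast
        with step out show ?thesis
          by (simp add: subtree_def)
      qed simp
    qed (simp add: subtree_def)
    then show ?thesis
      using start_through[OF Y(3)] assms(5) v by simp
  qed
qed

lemma flat_inner: "flat_path M q c \<Longrightarrow> M \<in> machines Z \<Longrightarrow> \<exists>c'. c' \<le> c \<and> inner_path M q c'"
proof (induction rule: flat_path.induct)
  case flat_start
  show ?case
    using inner_start by blast
next
  case (flat_step q c y q')
  then obtain c' where c': "c' \<le> c" "inner_path M q c'"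
    by blast
  have q: "contained Z M q"
    using flat_step.hyps(1) flat_step.prems by (rule flat_contained)
  then obtain K where K: "K \<in> subtree Z M" "K \<in> machines Z" "q \<in> states K"
    using flat_step.prems by (meson containedD)
  obtain A d where A: "acting Z q y = Some A" "chi Z q y = Some d" "0 \<le> d"
    using psi_SomeD[OF K(2,3) flat_step.hyps(2)] by metis
  show ?case
  proof (cases "A \<in> subtree Z M")
    case True
    then have "inner_path M q' (c' + d)"
      using c' A flat_step.hyps inner_step by blast
    then show ?thesis
      using c' A by (intro exI[of _ "c' + d"]) simp
  next
    case False
    then have "exits_subtree Z M q y"
      using A by (simp add: exits_subtree_def)
    then have "q' = start Z M"
      using reentry_at_start flat_step q by blast
    \<comment> \<open>Back at the start, the whole detour is exchanged for the empty path; its cost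
      0 is below \<open>c + d\<close> because \<open>c'\<close> and \<open>d\<close> are
      nonnegative.\<close>
    moreover have "0 \<le> c'"
      using c'(2) flat_step.prems
    proof (induction rule: inner_path.induct)
      case (inner_step q c y A q' d)
      then obtain K where "K \<in> machines Z" "q \<in> states K"
        by (meson containedD inner_contained)
      then obtain d' where "chi Z q y = Some d'" "0 \<le> d'"
        using inner_step.hyps(4) psi_SomeD by metis
      then show ?case
        using inner_step by simp
    qed simp
    ultimately show ?thesis
      using inner_start c' A by (intro exI[of _ 0]) auto
  qed
qed

lemma inner_path_append:
  assumes "inner_path N q c'" "inner_path M (start Z N) c" "N \<in> subtree Z M"
  shows "inner_path M q (c + c')"
  using assms(1)
proof (induction rule: inner_path.induct)
  case inner_start
  then show ?case
    using assms(2) by simp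
next
  case (inner_step q e y A q' d)
  then show ?case
    using inner_path.inner_step[of M q "c + e" y A q' d] subtree_trans assms(3) by (simp add: add.assoc)
qed

section \<open>Exit trajectories and paths\<close>

lemma exit_trajectory_flat:
  assumes "exit_trajectory E Z M x \<tau>" "i < length \<tau>"
  shows "flat_path M (fst (\<tau> ! i)) (\<Sum>j<i. the (chi Z (fst (\<tau> ! j)) (snd (\<tau> ! j))))"
  using assms(2)
proof (induction i)
  case 0
  then have "fst (\<tau> ! 0) = start Z M"
    using assms(1) by (simp add: exit_trajectory_def hd_conv_nth)
  then show ?case
    using flat_start by simp
next
  case (Suc i)
  have "psi Z (fst (\<tau> ! i)) (snd (\<tau> ! i)) = Some (fst (\<tau> ! Suc i))"
    using assms(1) Suc.prems by (simp add: exit_trajectory_def trajectory_def)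
  moreover have "contained Z M (fst (\<tau> ! Suc i))"
    using assms(1) nth_mem[OF Suc.prems] by (auto simp: exit_trajectory_def)
  ultimately show ?case
    using flat_step Suc by simp
qed

lemma trajectory_snoc:
  assumes "trajectory Z (\<tau> @ [(q, y)])" "psi Z q y = Some q'" "q' \<in> leaf_states Z" "x \<in> all_inputs Z"
  shows "trajectory Z ((\<tau> @ [(q, y)]) @ [(q', x)])"
  unfolding trajectory_def
proof (intro conjI allI impI)
  show "set ((\<tau> @ [(q, y)]) @ [(q', x)]) \<subseteq> leaf_states Z \<times> all_inputs Z"
    using assms unfolding trajectory_def by simp
  let ?\<tau> = "\<tau> @ [(q, y)]"
  fix i
  assume i: "Suc i < length (?\<tau> @ [(q', x)])"
  show "psi Z (fst ((?\<tau> @ [(q', x)]) ! i)) (snd ((?\<tau> @ [(q', x)]) ! i)) = Some (fst ((?\<tau> @ [(q', x)]) ! Suc i))"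
  proof (cases "Suc i < length ?\<tau>")
    case True
    then have "psi Z (fst (?\<tau> ! i)) (snd (?\<tau> ! i)) = Some (fst (?\<tau> ! Suc i))"
      using assms(1) unfolding trajectory_def by blast
    then show ?thesis
      using True by (simp only: nth_append[of ?\<tau>] Suc_lessD if_True)
  next
    case False
    with i have "i = length \<tau>"
      by simp
    then show ?thesis
      using assms(2) by (simp add: nth_append)
  qed
qed

text \<open>The last pair of a list is free, so appending \<open>z\<close> charges the pair that was
  last before.\<close>

lemma exit_cost_snoc:
  "exit_cost Z ((\<tau> @ [(q, y)]) @ [z]) = exit_cost Z (\<tau> @ [(q, y)]) + the (chi Z q y)"
proof -
  have "exit_cost Z ((\<tau> @ [(q, y)]) @ [z]) =
      (\<Sum>i<length \<tau>. the (chi Z (fst (\<tau> ! i)) (snd (\<tau> ! i)))) + the (chi Z q y)"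
    by (simp add: exit_cost_def nth_append)
  then show ?thesis
    by (simp add: exit_cost_def nth_append)
qed

text \<open>One list \<open>\<tau>\<close> must serve for every final input \<open>x\<close>: the
  input at \<open>q\<close> is the exit input if the path ends there and some other \<open>y\<close>
  if it continues. The cost is unaffected, since the last pair is free.\<close>

lemma inner_path_trajectory:
  assumes "inner_path M q c" "M \<in> machines Z"
  shows "\<exists>\<tau>. \<forall>x\<in>all_inputs Z. trajectory Z (\<tau> @ [(q, x)]) \<and> fst (hd (\<tau> @ [(q, x)])) = start Z M \<and>
    (\<forall>(q, y)\<in>set (\<tau> @ [(q, x)]). contained Z M q) \<and> exit_cost Z (\<tau> @ [(q, x)]) = c"
  using assms
proof (induction rule: inner_path.induct)
  case inner_start
  then show ?case
    using start_contained by (intro exI[of _ "[]"]) (auto simp: trajectory_def exit_cost_def contained_def)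
next
  case (inner_step q c y A q' d)
  then obtain \<tau> where \<tau>: "\<forall>x\<in>all_inputs Z. trajectory Z (\<tau> @ [(q, x)]) \<and> fst (hd (\<tau> @ [(q, x)])) = start Z M \<and>
    (\<forall>(q, y)\<in>set (\<tau> @ [(q, x)]). contained Z M q) \<and> exit_cost Z (\<tau> @ [(q, x)]) = c"
    by blast
  obtain K where "K \<in> machines Z" "q \<in> states K"
    using inner_step.hyps(1) inner_step.prems by (meson containedD inner_contained)
  then obtain p u where "delta A p y = Some u" "A \<in> machines Z"
    using acting_ancestor inner_step.hyps(2) by metis
  \<comment> \<open>Paths do not ask for legal inputs, but the acting machine has a transition with
    \<open>y\<close>, and its transitions are defined on its inputs only.\<close>
  then have y: "y \<in> all_inputs Z"
    using deltaD all_inputs_eq by blast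
  have q': "contained Z M q'"
    using inner_path.inner_step inner_step.hyps inner_step.prems by (blast intro: inner_contained)
  then have "q' \<in> leaf_states Z"
    by (simp add: contained_def)
  then show ?case
    using \<tau>[rule_format, OF y] q' inner_step.hyps
    by (intro exI[of _ "\<tau> @ [(q, y)]"]) (auto simp: exit_cost_snoc[simplified] trajectory_snoc[simplified] hd_append split: if_splits)
qed

text \<open>A transition acted on below \<open>M\<close> exits in neither sense. One that climbs out
  exits the subtree, and where it lands is decided at the parent state, which is exactly what
  \<open>reenters\<close> inspects.\<close>

lemma exits_target_eq:
  assumes "M \<in> machines Z" "contained Z M q" "\<not> reenters Z M x"
  shows "exits_target Z M q x \<longleftrightarrow> exits_subtree Z M q x"
proof -
  obtain K where K: "K \<in> subtree Z M" "q \<in> states K"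
    using assms by (meson containedD)
  from assms(1) K show ?thesis
  proof (cases rule: inside_or_up[where y = x])
    case (inside A v d)
    then show ?thesis
      by (simp add: exits_target_def exits_subtree_def)
  next
    case up
    have "\<not> (\<exists>v. climb (psi Z) M x = Some v \<and> contained Z M v)"
      using assms(3) by (auto simp: reenters_def climb_def split: option.splits)
    with up show ?thesis
      by (simp add: exits_target_def)
  qed
qed

lemma exit_trajectory_target_eq:
  assumes "M \<in> machines Z" "\<not> reenters Z M x"
  shows "exit_trajectory exits_target Z M x = exit_trajectory exits_subtree Z M x"
proof
  fix \<tau> :: "('q \<times> 'x) list"
  have "contained Z M (fst (last \<tau>))" if "\<tau> \<noteq> []" "\<forall>(q, y)\<in>set \<tau>. contained Z M q"
    using bspec[OF that(2) last_in_set[OF that(1)]] by (simp add: case_prod_unfold)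
  then show "exit_trajectory exits_target Z M x \<tau> = exit_trajectory exits_subtree Z M x \<tau>"
    unfolding exit_trajectory_def using exits_target_eq[OF assms(1) _ assms(2)] by blast
qed

end

text \<open>Abstracts from memory and marks: \<open>C\<close> satisfies one local equation per
  machine, in which only the values \<open>C\<close> takes at its children occur.\<close>

locale solved_hierarchy = hierarchy Z for Z :: "('q, 'x) himm" +
  fixes C :: "('q, 'x, real) mm \<Rightarrow> 'x \<Rightarrow> ereal"
  assumes C_least: "M \<in> machines Z \<Longrightarrow> x \<in> inputs M \<Longrightarrow>
    least_cost (augmented M (child_cost Z C M)) (Exit x) (C M x)"
    and C_nonneg: "M \<in> machines Z \<Longrightarrow> x \<in> inputs M \<Longrightarrow> 0 \<le> C M x"
begin

text \<open>Values are not too small: walks in the augmented machine are expanded to inner paths, by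
  induction on the tree and, within it, on the walk.\<close>

lemma C_realised:
  assumes "M \<in> machines Z" "x \<in> inputs M" "C M x \<noteq> \<infinity>"
  shows "\<exists>q c. inner_path M q c \<and> exits_subtree Z M q x \<and> C M x = ereal c"
  using assms
proof (induction M arbitrary: x rule: tree_induct)
  case (machine M)
  \<comment> \<open>Before input \<open>y\<close> can act at \<open>q\<close>, a refined
    \<open>q\<close> has to be traversed: append the child's optimal exit path for \<open>y\<close>.
    From its end \<open>q'\<close> the input climbs out and behaves as at \<open>q\<close>
    itself.\<close>
  have state_exit: "\<exists>q' d'. inner_path M q' (d + d') \<and> child_cost Z C M q y = ereal d' \<and>
      acting Z q' y = acting Z q y \<and> psi Z q' y = psi Z q y \<and> chi Z q' y = chi Z q y"
    if "inner_path M (entry M q) d" "y \<in> inputs M" "child_cost Z C M q y \<noteq> \<infinity>" for q d y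
  proof (cases "child Z M q")
    case None
    then show ?thesis
      using that by (intro exI[of _ q] exI[of _ 0]) (simp add: child_cost_def entry_def zero_ereal_def)
  next
    case (Some N)
    note N = childD[OF Some]
    have "y \<in> inputs N" and "C N y \<noteq> \<infinity>"
      using that child_inputs[OF Some] Some by (simp_all add: child_cost_def)
    then obtain q' d' where q': "inner_path N q' d'" "exits_subtree Z N q' y" "C N y = ereal d'"
      using machine.IH[OF N(4,3)] by blast
    then obtain K where "K \<in> subtree Z N" "q' \<in> states K"
      using N by (meson containedD inner_contained)
    with N(3) have "acting Z q' y = climb (acting Z) N y \<and> psi Z q' y = climb (psi Z) N y \<and> chi Z q' y = climb (chi Z) N y"
      by (cases rule: inside_or_up[where y = y]) (use q'(2) in \<open>auto simp: exits_subtree_def\<close>)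
    moreover have "inner_path M q' (d + d')"
      using that(1) Some q'(1) subtree_child by (intro inner_path_append) (simp_all add: entry_def)
    ultimately show ?thesis
      using q'(3) Some by (intro exI[of _ q'] exI[of _ d']) (simp add: climb_child[OF Some] child_cost_def)
  qed
  \<comment> \<open>A walk at \<open>St q\<close> corresponds to a path that has just entered
    \<open>q\<close>; the traversal of \<open>q\<close> is paid only when \<open>q\<close> is left,
    matching the weights of the augmented machine.\<close>
  have "case p of St q \<Rightarrow> \<exists>d. c = ereal d \<and> inner_path M (entry M q) d
      | Exit x \<Rightarrow> \<exists>q d. inner_path M q d \<and> exits_subtree Z M q x \<and> c = ereal d"
    if "reach (augmented M (child_cost Z C M)) p c" "c \<noteq> \<infinity>" for p c
    using that
  proof (induction rule: reach.induct)
    case reach_init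
    then show ?case
      using inner_start[of M] by (simp add: augmented_simps start_eq zero_ereal_def)
  next
    case (reach_step p c y p')
    from reach_step.hyps(2) show ?case
    proof (cases rule: augmented_delta_cases)
      case (move q v)
      have fin: "c \<noteq> \<infinity>" "child_cost Z C M q y \<noteq> \<infinity>"
        using reach_step.prems move by (auto simp: augmented_simps)
      with reach_step.IH move obtain d where d: "c = ereal d" "inner_path M (entry M q) d"
        by auto
      then obtain q' d' where q': "inner_path M q' (d + d')" "child_cost Z C M q y = ereal d'"
        "acting Z q' y = acting Z q y" "psi Z q' y = psi Z q y" "chi Z q' y = chi Z q y"
        using state_exit fin move by blast
      have "inner_path M (entry M v) (d + d' + gamma M q y)"
        using inner_step[OF q'(1)] q' step_here[OF machine.prems(1) move(5)] by simp
      then show ?thesis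
        using d q' move by (simp add: augmented_simps add.assoc)
    next
      case (exit q)
      have fin: "c \<noteq> \<infinity>" "child_cost Z C M q y \<noteq> \<infinity>"
        using reach_step.prems exit by (auto simp: augmented_simps)
      with reach_step.IH exit obtain d where d: "c = ereal d" "inner_path M (entry M q) d"
        by auto
      then obtain q' d' where q': "inner_path M q' (d + d')" "child_cost Z C M q y = ereal d'"
        "acting Z q' y = acting Z q y"
        using state_exit fin exit by blast
      have "exits_subtree Z M q' y"
        using q'(3) step_up(1)[OF machine.prems(1) exit(3,5)] climb_acting_outside by (simp add: exits_subtree_def)
      then show ?thesis
        using d q' exit by (auto simp: augmented_simps)
    qed
  qed
  from this[of "Exit x" "C M x"] show ?case
    using C_least[OF machine.prems(1,2)] machine.prems(3) by (simp add: least_cost_def)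
qed

text \<open>Values are not too large: an inner path is compressed to a walk in the augmented machine
  that costs at most as much.\<close>

lemma C_lower_bound:
  assumes "M \<in> machines Z" "x \<in> inputs M" "inner_path M q c" "exits_subtree Z M q x"
  shows "C M x \<le> ereal c"
  using assms
proof (induction M arbitrary: x q c rule: tree_induct)
  case (machine M)
  define R where "R = reach (augmented M (child_cost Z C M))"
  \<comment> \<open>At each moment \<open>c1\<close> is the cost of a walk to the current state
    \<open>p\<close> of \<open>M\<close>, and \<open>c2\<close> what has been spent so far inside
    the child at \<open>p\<close>. It is an inequality because finished visits of children are
    replaced by their possibly cheaper stored costs.\<close>
  define split_path where "split_path = (\<lambda>q c. \<exists>p\<in>states M. \<exists>c1 c2. R (St p) (ereal c1) \<and> c1 + c2 \<le> c \<and>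
    (case child Z M p of None \<Rightarrow> q = p \<and> c2 = 0 | Some N \<Rightarrow> inner_path N q c2))"
  have entry_split: "split_path (entry M p) c" if "p \<in> states M" "R (St p) c'" "0 \<le> c'" "c' \<le> ereal c" for p c' c
  proof -
    \<comment> \<open>Squeezed between 0 and a real number, the cost of the walk is finite.\<close>
    have "c' = ereal (real_of_ereal c')"
      using that(3,4) by (cases c') auto
    then obtain c1 where "c' = ereal c1" ..
    then show ?thesis
      using that unfolding split_path_def entry_def
      by (intro bexI[of _ p] exI[of _ c1] exI[of _ 0]) (auto intro: inner_start split: option.split)
  qed
  \<comment> \<open>The induction hypothesis for children enters here: a visit that ends with input
    \<open>y\<close> has cost at least the stored one.\<close>
  have exit_cost_bound: "child_cost Z C M p y \<le> ereal c2"
    if "p \<in> states M" "y \<in> inputs M" "case child Z M p of None \<Rightarrow> q = p \<and> c2 = 0 | Some N \<Rightarrow> inner_path N q c2"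
      "\<And>N. child Z M p = Some N \<Longrightarrow> exits_subtree Z N q y" for p y q c2
  proof (cases "child Z M p")
    case (Some N)
    then show ?thesis
      using that machine.IH[of N y q c2] childD[OF Some] child_inputs[OF Some]
      by (simp add: child_cost_def)
  qed (use that in \<open>simp add: child_cost_def\<close>)
  have child_cost_nonneg: "0 \<le> child_cost Z C M p y" if "y \<in> inputs M" for p y
    using that C_nonneg[OF childD(3)] child_inputs
    by (simp add: child_cost_def split: option.split)
  have R_nonneg: "0 \<le> c" if "R p c" for p c
  proof (rule reach_nonneg[OF that[unfolded R_def]])
    show "nonneg_mm (augmented M (child_cost Z C M))"
      by (rule augmented_nonneg) (simp_all add: machine_is_mm machine.prems child_cost_nonneg)
  qed
  have climb_out: "acting Z q y = acting Z p y \<and> psi Z q y = psi Z p y \<and> chi Z q y = chi Z p y"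
    if "child Z M p = Some N" "inner_path N q c2" "exits_subtree Z N q y" for p N q c2 y
  proof -
    have "contained Z N q"
      using that(2) childD(3)[OF that(1)] by (rule inner_contained)
    then obtain K where "K \<in> subtree Z N" "q \<in> states K"
      using childD(3)[OF \<open>child Z M p = Some N\<close>] by (rule containedD)
    with childD(3)[OF that(1)] show ?thesis
      by (cases rule: inside_or_up[where y = y])
        (use that(3) in \<open>auto simp: exits_subtree_def climb_child[OF that(1)]\<close>)
  qed
  have "split_path q c"
    using machine.prems(3)
  proof (induction rule: inner_path.induct)
    case inner_start
    have "R (St (init M)) 0"
      unfolding R_def by (metis augmented_simps(1) reach_init)
    then show ?case
      unfolding start_eq by (rule entry_split[rotated]) (simp_all add: is_mmD machine_is_mm machine.prems)
  next
    case (inner_step q c y A q' d)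
    then obtain p c1 c2 where p: "p \<in> states M" "R (St p) (ereal c1)" "c1 + c2 \<le> c"
      "case child Z M p of None \<Rightarrow> q = p \<and> c2 = 0 | Some N \<Rightarrow> inner_path N q c2"
      unfolding split_path_def by blast
    show ?case
    \<comment> \<open>A transition acted on within the child at \<open>p\<close> only increases
      \<open>c2\<close>. Any other one completes the visit and becomes an arc of the augmented
      machine.\<close>
    proof (cases "\<exists>N. child Z M p = Some N \<and> A \<in> subtree Z N")
      case True
      then obtain N where N: "child Z M p = Some N" "A \<in> subtree Z N"
        by blast
      then have "inner_path N q' (c2 + d)"
        using p(4) inner_step.hyps inner_path.inner_step by simp
      moreover have "c1 + (c2 + d) \<le> c + d"
        using p(3) by simp
      ultimately show ?thesis
        using p(1,2) N(1) unfolding split_path_def by (metis option.case(2))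
    next
      case False
      then have ex: "exits_subtree Z N q y" if "child Z M p = Some N" for N
        using that inner_step.hyps by (auto simp: exits_subtree_def)
      have same: "acting Z q y = acting Z p y \<and> psi Z q y = psi Z p y \<and> chi Z q y = chi Z p y"
        using p(4) climb_out ex by (auto split: option.splits)
      \<comment> \<open>Otherwise the transition would climb out of \<open>M\<close>, but on an
        inner path it is acted on below \<open>M\<close>.\<close>
      have "delta M p y \<noteq> None"
      proof
        assume "delta M p y = None"
        then have "acting Z q y = climb (acting Z) M y"
          using same step_up(1) machine.prems(1) p(1) by simp
        then show False
          using climb_acting_outside inner_step.hyps by metis
      qed
      then obtain v where v: "delta M p y = Some v"
        by blast
      note dv = deltaD[OF machine.prems(1) v]
      have q': "q' = entry M v" "d = gamma M p y"
        using same step_here[OF machine.prems(1) v] inner_step.hyps by simp_all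
      have "R (St v) (ereal c1 + (child_cost Z C M p y + ereal d))"
        using reach_step[OF p(2)[unfolded R_def], of y "St v"] v dv unfolding R_def q'(2)
        by (simp add: augmented_simps)
      moreover have "ereal c1 + (child_cost Z C M p y + ereal d) \<le> ereal (c + d)"
      proof -
        have "child_cost Z C M p y \<le> ereal c2"
          using exit_cost_bound[OF p(1) dv(2) p(4)] ex by blast
        then have "ereal c1 + (child_cost Z C M p y + ereal d) \<le> ereal c1 + (ereal c2 + ereal d)"
          by (intro add_mono) simp_all
        also have "\<dots> \<le> ereal (c + d)"
          using p(3) by simp
        finally show ?thesis .
      qed
      ultimately show ?thesis
        unfolding q'(1) using entry_split dv(3) R_nonneg by blast
    qed
  qed
  then obtain p c1 c2 where p: "p \<in> states M" "R (St p) (ereal c1)" "c1 + c2 \<le> c"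
      "case child Z M p of None \<Rightarrow> q = p \<and> c2 = 0 | Some N \<Rightarrow> inner_path N q c2"
    unfolding split_path_def by blast
  have ex: "exits_subtree Z N q x" if "child Z M p = Some N" for N
    using machine.prems(4) subtree_trans[OF subtree_child[OF that]] by (auto simp: exits_subtree_def)
  have same: "acting Z q x = acting Z p x"
    using p(4) climb_out ex by (auto split: option.splits)
  have "delta M p x = None"
  proof (rule ccontr)
    assume "delta M p x \<noteq> None"
    then have "acting Z q x = Some M"
      using same step_here(1) machine.prems(1) by auto
    then show False
      using machine.prems(4) by (simp add: exits_subtree_def)
  qed
  then have "R (Exit x) (ereal c1 + child_cost Z C M p x)"
    using reach_step[OF p(2)[unfolded R_def], of x "Exit x"] p(1) machine.prems(2) unfolding R_def
    by (simp add: augmented_simps)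
  then have "C M x \<le> ereal c1 + child_cost Z C M p x"
    using C_least[OF machine.prems(1,2)] unfolding R_def least_cost_def by blast
  also have "\<dots> \<le> ereal c1 + ereal c2"
    using exit_cost_bound[OF p(1) machine.prems(2) p(4)] ex by (intro add_mono) simp_all
  also have "\<dots> \<le> ereal c"
    using p(3) by simp
  finally show ?case .
qed

lemma C_optimal:
  assumes "M \<in> machines Z" "x \<in> inputs M"
  shows "is_optimal_exit_cost exits_subtree Z M x (C M x)"
proof -
  have lower: "C M x \<le> ereal (exit_cost Z \<tau>)" if \<tau>: "exit_trajectory exits_subtree Z M x \<tau>" for \<tau>
  proof -
    have "\<tau> \<noteq> []"
      using \<tau> by (simp add: exit_trajectory_def)
    then have "flat_path M (fst (last \<tau>)) (exit_cost Z \<tau>)"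
      using exit_trajectory_flat[OF \<tau>, of "length \<tau> - 1"] by (simp add: exit_cost_def last_conv_nth)
    then obtain c where "c \<le> exit_cost Z \<tau>" "inner_path M (fst (last \<tau>)) c"
      using flat_inner assms(1) by blast
    moreover have "exits_subtree Z M (fst (last \<tau>)) x"
      using \<tau> by (auto simp: exit_trajectory_def)
    ultimately show ?thesis
      using C_lower_bound[OF assms] by (meson ereal_less_eq(3) order_trans)
  qed
  have attained: "\<exists>\<tau>. exit_trajectory exits_subtree Z M x \<tau> \<and> C M x = ereal (exit_cost Z \<tau>)"
    if fin: "C M x \<noteq> \<infinity>"
  proof -
    obtain q c where q: "inner_path M q c" "exits_subtree Z M q x" "C M x = ereal c"
      using C_realised[OF assms fin] by blast
    have "x \<in> all_inputs Z"
      using assms all_inputs_eq by simp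
    with inner_path_trajectory[OF q(1) assms(1)] obtain \<tau> where
      "trajectory Z (\<tau> @ [(q, x)]) \<and> fst (hd (\<tau> @ [(q, x)])) = start Z M \<and>
       (\<forall>(q, y)\<in>set (\<tau> @ [(q, x)]). contained Z M q) \<and> exit_cost Z (\<tau> @ [(q, x)]) = c"
      by blast
    then have "exit_trajectory exits_subtree Z M x (\<tau> @ [(q, x)])" "C M x = ereal (exit_cost Z (\<tau> @ [(q, x)]))"
      using q by (simp_all add: exit_trajectory_def)
    then show ?thesis
      by blast
  qed
  \<comment> \<open>Exit costs are real, so one exit trajectory forces a finite value; conversely a
    finite value is attained. Thus \<infinity> occurs exactly when there is no exit
    trajectory.\<close>
  have "C M x \<noteq> \<infinity>" if "\<exists>\<tau>. exit_trajectory exits_subtree Z M x \<tau>"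
    using that lower by force
  then show ?thesis
    unfolding is_optimal_exit_cost_def using lower attained by (meson ereal_infty_less_eq(1))
qed

lemma C_optimal_target:
  assumes "M \<in> machines Z" "x \<in> inputs M" "\<not> reenters Z M x"
  shows "is_optimal_exit_cost exits_target Z M x (C M x)"
  using C_optimal[OF assms(1,2)] exit_trajectory_target_eq[OF assms(1,3)]
  unfolding is_optimal_exit_cost_def by simp

end

section \<open>Runs of the algorithm\<close>

text \<open>The run \<open>D\<close> is existentially quantified because ties may have been broken
  in any way when the entry was computed.\<close>

definition solved_at ::
  "('q, 'x) himm \<Rightarrow> (('q, 'x, real) mm \<Rightarrow> ('q, 'x) exit_result) \<Rightarrow> ('q, 'x, real) mm \<Rightarrow> bool" where
  "solved_at Z t M \<longleftrightarrow>
     (\<exists>D. dijkstra (augmented M (child_cost Z (\<lambda>N x. fst (t N x)) M)) D \<and> t M = read_exits D)"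

definition sound_entry :: "('q, 'x) himm \<Rightarrow> ('q, 'x) memo \<Rightarrow> ('q, 'x, real) mm \<Rightarrow> bool" where
  "sound_entry Z \<sigma> M \<longleftrightarrow>
     (\<forall>q N. child Z M q = Some N \<longrightarrow> N \<notin> marked \<sigma>) \<and> solved_at Z (table \<sigma>) M"

text \<open>Marks are confined to the machines of \<open>Z\<close> so that merging memories cannot
  mark machines of the other hierarchy, and so that a finished run leaves no mark at all.\<close>

definition sound_memo :: "('q, 'x) himm \<Rightarrow> ('q, 'x) memo \<Rightarrow> bool" where
  "sound_memo Z \<sigma> \<longleftrightarrow> marked \<sigma> \<subseteq> machines Z \<and> (\<forall>M\<in>machines Z - marked \<sigma>. sound_entry Z \<sigma> M)"

lemma sound_memoD:
  "sound_memo Z \<sigma> \<Longrightarrow> marked \<sigma> \<subseteq> machines Z"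
  "sound_memo Z \<sigma> \<Longrightarrow> M \<in> machines Z \<Longrightarrow> M \<notin> marked \<sigma> \<Longrightarrow> sound_entry Z \<sigma> M"
  by (simp_all add: sound_memo_def)

lemma child_cost_cong:
  assumes "child Z' M = child Z M" "\<And>q N. child Z M q = Some N \<Longrightarrow> C' N = C N"
  shows "child_cost Z' C' M = child_cost Z C M"
  using assms by (intro ext) (simp add: child_cost_def split: option.split)

text \<open>The locality of the invariant. The last hypothesis need only treat unmarked children,
  because a sound entry has no others.\<close>

lemma sound_entry_cong:
  assumes "sound_entry Z \<sigma> M" "child Z' M = child Z M" "table \<sigma>' M = table \<sigma> M"
    and "\<And>q N. child Z M q = Some N \<Longrightarrow> N \<notin> marked \<sigma> \<Longrightarrow> N \<notin> marked \<sigma>' \<and> table \<sigma>' N = table \<sigma> N"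
  shows "sound_entry Z' \<sigma>' M"
proof -
  have *: "N \<notin> marked \<sigma>' \<and> table \<sigma>' N = table \<sigma> N" if "child Z M q = Some N" for q N
    using assms(1,4) that unfolding sound_entry_def by blast
  have "child_cost Z' (\<lambda>N x. fst (table \<sigma>' N x)) M = child_cost Z (\<lambda>N x. fst (table \<sigma> N x)) M"
    by (rule child_cost_cong[OF assms(2)]) (simp add: *)
  then show ?thesis
    using assms(1-3) * by (simp add: sound_entry_def solved_at_def)
qed

section \<open>Existence and soundness of runs\<close>

context hierarchy
begin

lemma visit_exists:
  assumes "\<And>N \<sigma>. (M, N) \<in> edges Z \<Longrightarrow> \<exists>r \<sigma>'. optimal_exit Z N \<sigma> r \<sigma>'"
  shows "\<exists>c \<sigma>'. visit Z M qs \<sigma> c \<sigma>'"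
proof (induction qs arbitrary: \<sigma>)
  case Nil
  show ?case
    using visit_nil by blast
next
  case (Cons q qs)
  show ?case
  proof (cases "child Z M q")
    case None
    obtain c \<sigma>' where "visit Z M qs \<sigma> c \<sigma>'"
      using Cons by blast
    then have "visit Z M (q # qs) \<sigma> (c(q := (\<lambda>x. 0))) \<sigma>'"
      by (rule visit_leaf[OF None])
    then show ?thesis
      by (intro exI)
  next
    case (Some N)
    then obtain r \<sigma>' where "optimal_exit Z N \<sigma> r \<sigma>'"
      using assms childD(4) by blast
    moreover obtain c \<sigma>'' where "visit Z M qs \<sigma>' c \<sigma>''"
      using Cons by blast
    ultimately have "visit Z M (q # qs) \<sigma> (c(q := (\<lambda>x. fst (r x)))) \<sigma>''"
      by (rule visit_child[OF Some])
    then show ?thesis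
      by (intro exI)
  qed
qed

lemma optimal_exit_exists: "M \<in> machines Z \<Longrightarrow> \<exists>r \<sigma>'. optimal_exit Z M \<sigma> r \<sigma>'"
proof (induction M arbitrary: \<sigma> rule: tree_induct)
  case (machine M)
  show ?case
  proof (cases "M \<in> marked \<sigma>")
    case True
    obtain qs where qs: "set qs = states M" "distinct qs"
      using finite_distinct_list is_mmD(1) machine_is_mm machine.prems by metis
    obtain c \<sigma>' where "visit Z M qs \<sigma> c \<sigma>'"
      using visit_exists machine.IH edge_machines by blast
    moreover obtain D where "dijkstra (augmented M c) D"
      using augmented_dijkstra_exists machine_is_mm machine.prems by blast
    ultimately show ?thesis
      using optimal_exit_visit.marked[OF True qs(2,1)] by blast
  qed (use optimal_exit_visit.unmarked in blast)
qed

text \<open>The frame conditions make the mutual induction work: results of unmarked machines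
  persist, so values read for earlier children stay valid while later ones are visited, and marks
  disappear only below the machine called, so \<open>M\<close> stays marked during its own
  loop.\<close>

lemma optimal_exit_sound:
  "optimal_exit Z M \<sigma> r \<sigma>' \<Longrightarrow> M \<in> machines Z \<Longrightarrow> sound_memo Z \<sigma> \<Longrightarrow>
     sound_memo Z \<sigma>' \<and> r = table \<sigma>' M \<and> M \<notin> marked \<sigma>' \<and> marked \<sigma>' \<subseteq> marked \<sigma> \<and>
     (\<forall>N\<in>marked \<sigma> - marked \<sigma>'. (M, N) \<in> (edges Z)\<^sup>*) \<and>
     (\<forall>N. N \<notin> marked \<sigma> \<longrightarrow> table \<sigma>' N = table \<sigma> N)"
  and visit_sound:
  "visit Z M qs \<sigma> c \<sigma>' \<Longrightarrow> M \<in> machines Z \<Longrightarrow> sound_memo Z \<sigma> \<Longrightarrow> distinct qs \<Longrightarrow>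
     sound_memo Z \<sigma>' \<and> marked \<sigma>' \<subseteq> marked \<sigma> \<and>
     (\<forall>N\<in>marked \<sigma> - marked \<sigma>'. (M, N) \<in> (edges Z)\<^sup>+) \<and>
     (\<forall>N. N \<notin> marked \<sigma> \<longrightarrow> table \<sigma>' N = table \<sigma> N) \<and>
     (\<forall>q\<in>set qs. \<forall>N. child Z M q = Some N \<longrightarrow> N \<notin> marked \<sigma>') \<and>
     (\<forall>q. c q = (if q \<in> set qs then child_cost Z (\<lambda>N x. fst (table \<sigma>' N x)) M q else (\<lambda>x. 0)))"
proof (induction rule: optimal_exit_visit.inducts)
  case (unmarked M \<sigma>)
  then show ?case
    by simp
next
  case (marked M \<sigma> qs c \<sigma>' D r)
  let ?\<sigma> = "\<sigma>'\<lparr>marked := marked \<sigma>' - {M}, table := (table \<sigma>')(M := r)\<rparr>"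
  have visit: "sound_memo Z \<sigma>'" "marked \<sigma>' \<subseteq> marked \<sigma>" "\<forall>N\<in>marked \<sigma> - marked \<sigma>'. (M, N) \<in> (edges Z)\<^sup>+"
    "\<forall>N. N \<notin> marked \<sigma> \<longrightarrow> table \<sigma>' N = table \<sigma> N"
    "\<forall>q\<in>set qs. \<forall>N. child Z M q = Some N \<longrightarrow> N \<notin> marked \<sigma>'"
    "\<forall>q. c q = (if q \<in> set qs then child_cost Z (\<lambda>N x. fst (table \<sigma>' N x)) M q else (\<lambda>x. 0))"
    using marked.IH marked.prems marked.hyps(2) by blast+
  have M: "M \<in> marked \<sigma>'"
    using visit(3) marked.hyps(1) acyclic_edges by blast
  have no_loop: "N \<noteq> M" if "child Z M q = Some N" for q N
    using childD(4)[OF that] acyclic_edges by blast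
  have "c = child_cost Z (\<lambda>N x. fst (table \<sigma>' N x)) M"
  proof
    fix q
    show "c q = child_cost Z (\<lambda>N x. fst (table \<sigma>' N x)) M q"
    proof (cases "q \<in> set qs")
      \<comment> \<open>Such a \<open>q\<close> is not a state of \<open>M\<close>, hence has no
        child, and both sides take the default value 0.\<close>
      case False
      then have "child Z M q = None"
        using marked.hyps(3) childD(2) by (metis not_None_eq)
      with False visit(6) show ?thesis
        by (simp add: child_cost_def fun_eq_iff)
    qed (simp add: visit(6))
  qed
  also have "\<dots> = child_cost Z (\<lambda>N x. fst (table ?\<sigma> N x)) M"
    by (rule child_cost_cong) (auto dest: no_loop)
  finally have "solved_at Z (table ?\<sigma>) M"
    using marked.hyps(4,5) by (auto simp: solved_at_def)
  moreover have "N \<notin> marked ?\<sigma>" if "child Z M q = Some N" for q N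
    using visit(5) childD(2)[OF that] marked.hyps(3) that by simp
  ultimately have new: "sound_entry Z ?\<sigma> M"
    by (simp add: sound_entry_def)
  \<comment> \<open>Overwriting the entry of \<open>M\<close> harms no other: \<open>M\<close> is
    still marked in \<open>\<sigma>'\<close>, so it is neither an unmarked machine nor a child of a
    machine with a sound entry.\<close>
  have old: "sound_entry Z ?\<sigma> N" if "N \<in> machines Z" "N \<notin> marked \<sigma>'" for N
  proof (rule sound_entry_cong)
    show "sound_entry Z \<sigma>' N"
      using sound_memoD(2)[OF visit(1)] that by blast
  qed (use M that(2) in auto)
  have "sound_memo Z ?\<sigma>"
    unfolding sound_memo_def
  proof (intro conjI ballI)
    show "marked ?\<sigma> \<subseteq> machines Z"
      using sound_memoD(1)[OF visit(1)] by auto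
    fix N
    assume "N \<in> machines Z - marked ?\<sigma>"
    then show "sound_entry Z ?\<sigma> N"
      using new old by (cases "N = M") auto
  qed
  moreover have "(M, N) \<in> (edges Z)\<^sup>*" if "N \<in> marked \<sigma> - marked ?\<sigma>" for N
    using that visit(3) by (cases "N = M") (auto dest: trancl_into_rtrancl)
  ultimately show ?case
    using visit(2,4) marked.hyps(1) by auto
next
  case (visit_nil M \<sigma>)
  then show ?case
    by simp
next
  case (visit_leaf M q qs \<sigma> c \<sigma>')
  then show ?case
    by (simp add: child_cost_def fun_eq_iff)
next
  case (visit_child M q N \<sigma> r \<sigma>' qs c \<sigma>'')
  note N = childD[OF visit_child(1)]
  have exit: "sound_memo Z \<sigma>'" "r = table \<sigma>' N" "N \<notin> marked \<sigma>'" "marked \<sigma>' \<subseteq> marked \<sigma>"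
     "\<forall>K\<in>marked \<sigma> - marked \<sigma>'. (N, K) \<in> (edges Z)\<^sup>*"
     "\<forall>K. K \<notin> marked \<sigma> \<longrightarrow> table \<sigma>' K = table \<sigma> K"
    using visit_child(3)[OF N(3) visit_child(7)] by simp_all
  have qs: "distinct qs" "q \<notin> set qs"
    using visit_child(8) by simp_all
  have visit: "sound_memo Z \<sigma>''" "marked \<sigma>'' \<subseteq> marked \<sigma>'" "\<forall>K\<in>marked \<sigma>' - marked \<sigma>''. (M, K) \<in> (edges Z)\<^sup>+"
    "\<forall>K. K \<notin> marked \<sigma>' \<longrightarrow> table \<sigma>'' K = table \<sigma>' K"
    "\<forall>q\<in>set qs. \<forall>K. child Z M q = Some K \<longrightarrow> K \<notin> marked \<sigma>''"
    "\<forall>q. c q = (if q \<in> set qs then child_cost Z (\<lambda>N x. fst (table \<sigma>'' N x)) M q else (\<lambda>x. 0))"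
    using visit_child(5)[OF N(1) exit(1) qs(1)] by blast+
  have "(M, K) \<in> (edges Z)\<^sup>+" if "K \<in> marked \<sigma> - marked \<sigma>''" for K
  proof (cases "K \<in> marked \<sigma>'")
    case False
    then have "(N, K) \<in> (edges Z)\<^sup>*"
      using that exit(5) by blast
    with N(4) show ?thesis
      by (rule rtrancl_into_trancl2)
  qed (use that visit(3) in blast)
  moreover have "table \<sigma>'' K = table \<sigma> K" if "K \<notin> marked \<sigma>" for K
    using that exit(4,6) visit(4) by (metis subsetD)
  moreover have "K \<notin> marked \<sigma>''" if "p \<in> set (q # qs)" "child Z M p = Some K" for p K
    using that visit_child(1) exit(3) visit(2,5) by auto
  \<comment> \<open>The costs \<open>r\<close> were read before the rest of the loop;
    \<open>N\<close> was unmarked by then, so its table entry is still \<open>r\<close> at the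
    end.\<close>
  moreover have "(c(q := \<lambda>x. fst (r x))) p = (if p \<in> set (q # qs)
      then child_cost Z (\<lambda>N x. fst (table \<sigma>'' N x)) M p else (\<lambda>x. 0))" for p
    using visit(4,6) exit(2,3) visit_child(1) by (simp add: child_cost_def fun_eq_iff)
  ultimately show ?case
    using visit(1,2) exit(4) by blast
qed

text \<open>The call at the root unmarks the root, and by the invariant being unmarked spreads along
  arcs to every machine.\<close>

lemma compute_sound:
  assumes "compute_optimal_exits Z \<sigma> r \<sigma>'" "sound_memo Z \<sigma>"
  shows "sound_memo Z \<sigma>'" "r = table \<sigma>' (root_mm Z)" "marked \<sigma>' = {}"
proof -
  note exit = optimal_exit_sound[OF assms(1)[unfolded compute_optimal_exits_def] root_mm_machine assms(2)]
  then show "sound_memo Z \<sigma>'" "r = table \<sigma>' (root_mm Z)"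
    by simp_all
  have "M \<notin> marked \<sigma>'" if "(root_mm Z, M) \<in> (edges Z)\<^sup>*" for M
    using that
  proof induction
    case (step M N)
    then have "sound_entry Z \<sigma>' M"
      using exit edge_machines sound_memoD(2) by blast
    with step.hyps(2) show ?case
      unfolding sound_entry_def edges_def by blast
  qed (use exit in simp)
  then show "marked \<sigma>' = {}"
    using sound_memoD(1) exit root_mm_reaches by blast
qed

text \<open>Dijkstra's algorithm is correct only for nonnegative weights, and the weights of
  \<open>M\<close> contain the values of its children; so minimality and nonnegativity are proved
  together, from the leaves upwards.\<close>

lemma unmarked_memo_solves:
  assumes "sound_memo Z \<sigma>" "marked \<sigma> = {}"
  shows "solved_hierarchy Z (\<lambda>M x. fst (table \<sigma> M x))"
proof -
  let ?C = "\<lambda>M x. fst (table \<sigma> M x)"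
  have "least_cost (augmented M (child_cost Z ?C M)) (Exit x) (?C M x) \<and> 0 \<le> ?C M x"
    if "M \<in> machines Z" "x \<in> inputs M" for M x
    using that
  proof (induction M arbitrary: x rule: tree_induct)
    case (machine M)
    obtain D where D: "dijkstra (augmented M (child_cost Z ?C M)) D" "table \<sigma> M = read_exits D"
      using assms machine.prems(1) unfolding sound_memo_def sound_entry_def solved_at_def by blast
    have nonneg: "nonneg_mm (augmented M (child_cost Z ?C M))"
    proof (rule augmented_nonneg)
      fix q y
      assume y: "y \<in> inputs M"
      show "0 \<le> child_cost Z ?C M q y"
      proof (cases "child Z M q")
        case (Some N)
        then show ?thesis
          using machine.IH[OF childD(4,3)[OF Some], of y] y child_inputs[OF Some]
          by (simp add: child_cost_def)
      qed (simp add: child_cost_def)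
    qed (simp add: machine.prems machine_is_mm)
    have "least_cost (augmented M (child_cost Z ?C M)) (Exit x) (?C M x)"
      using read_exits_least[OF D(1) nonneg] D(2) by simp
    then show ?case
      using reach_nonneg[OF _ nonneg] by (auto simp: least_cost_def)
  qed
  then show ?thesis
    by unfold_locales blast+
qed

end

section \<open>Modifications\<close>

text \<open>\<open>M\<close> and its parent are exempt from the hypothesis, as their arcs or states
  may have changed. Marking all ancestors keeps the unmarked machines closed under children.\<close>

lemma sound_memo_mark:
  assumes "is_himm Z" "M \<in> machines Z"
    and "\<And>N. N \<in> machines Z \<Longrightarrow> N \<notin> marked \<sigma> \<Longrightarrow> N \<noteq> M \<Longrightarrow> \<forall>q. child Z N q \<noteq> Some M \<Longrightarrow> sound_entry Z \<sigma> N"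
  shows "sound_memo Z (mark Z M \<sigma>)"
  unfolding sound_memo_def
proof (intro conjI ballI)
  interpret hierarchy Z
    by unfold_locales (rule assms(1))
  have "W \<in> machines Z" if "(W, M) \<in> (edges Z)\<^sup>+" for W
    using that edge_machines by (blast dest: tranclD)
  then show "marked (mark Z M \<sigma>) \<subseteq> machines Z"
    using assms(2) by (auto simp: mark_def)
  fix N
  assume N: "N \<in> machines Z - marked (mark Z M \<sigma>)"
  then have N': "N \<in> machines Z" "N \<notin> marked \<sigma>" "N \<noteq> M" "(N, M) \<notin> (edges Z)\<^sup>+"
    by (auto simp: mark_def)
  \<comment> \<open>A child of a machine that is not above \<open>M\<close> is itself neither
    \<open>M\<close> nor above \<open>M\<close>, so \<open>mark\<close> does not mark it
    anew.\<close>
  have not_up: "(K, M) \<notin> (edges Z)\<^sup>*" if "child Z N q = Some K" for q K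
    using childD(4)[OF that] N'(4) by (blast intro: rtrancl_into_trancl2)
  then have "\<forall>q. child Z N q \<noteq> Some M"
    by blast
  with N' have "sound_entry Z \<sigma> N"
    using assms(3) by blast
  then show "sound_entry Z (mark Z M \<sigma>) N"
  proof (rule sound_entry_cong)
    fix q K
    assume "child Z N q = Some K" "K \<notin> marked \<sigma>"
    then show "K \<notin> marked (mark Z M \<sigma>) \<and> table (mark Z M \<sigma>) K = table \<sigma> K"
      using not_up[of q K] by (auto simp: mark_def dest: trancl_into_rtrancl)
  qed (simp_all add: mark_def)
qed

text \<open>Covers state addition, state removal and arc modification at once. \<open>kept\<close>
  demands that refined states survive; for a removal the arc of the removed state is pruned
  beforehand.\<close>

locale machine_replacement = hierarchy Z for Z :: "('q, 'x) himm" +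
  fixes M M' :: "('q, 'x, real) mm"
  assumes M: "M \<in> machines Z"
    and M': "is_mm M'" "inputs M' = inputs M" "outputs M' = outputs M"
    and fresh: "N \<in> machines Z \<Longrightarrow> N \<noteq> M \<Longrightarrow> states M' \<inter> states N = {}"
    and kept: "child Z M q = Some N \<Longrightarrow> q \<in> states M'"
begin

abbreviation Z' where "Z' \<equiv> replace_mm Z M M'"

text \<open>The renaming that is local to \<open>replace_mm\<close>. It is injective on the machines
  of \<open>Z\<close>, as \<open>M'\<close> shares no state with the machines other than
  \<open>M\<close>.\<close>

definition exchange where "exchange N = (if N = M then M' else N)"

lemma not_M': "N \<in> machines Z \<Longrightarrow> N \<noteq> M \<Longrightarrow> N \<noteq> M'"
  using fresh is_mmD(3)[OF M'(1)] by blast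

lemma exchange_M: "exchange M = M'"
  and exchange_other: "N \<noteq> M \<Longrightarrow> exchange N = N"
  by (simp_all add: exchange_def)

lemma exchange_inj: "A \<in> machines Z \<Longrightarrow> B \<in> machines Z \<Longrightarrow> exchange A = exchange B \<Longrightarrow> A = B"
  using not_M' by (auto simp: exchange_def split: if_splits)

lemma machines_replace: "machines Z' = exchange ` machines Z"
  by (simp add: replace_mm_def exchange_def[abs_def] Let_def)

lemma M'_machine: "M' \<in> machines Z'"
  using M exchange_M by (force simp: machines_replace)

lemma child_replace: "W \<in> machines Z \<Longrightarrow> child Z' (exchange W) q = map_option exchange (child Z W q)"
  using not_M' by (auto simp: replace_mm_def exchange_def[abs_def] Let_def)

lemma child_replace_other: "W \<in> machines Z \<Longrightarrow> W \<noteq> M \<Longrightarrow> child Z' W q = map_option exchange (child Z W q)"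
  using child_replace[of W q] by (simp add: exchange_other)

lemma child_replace_M': "child Z' M' q = map_option exchange (child Z M q)"
  using child_replace[OF M, of q] by (simp add: exchange_M)

lemma child_replaceD:
  assumes "child Z' W q = Some N"
  obtains A B where "W = exchange A" "N = exchange B" "child Z A q = Some B"
proof -
  have "W \<in> machines Z'"
    using assms by (auto simp: replace_mm_def Let_def split: if_splits)
  then obtain A where "A \<in> machines Z" "W = exchange A"
    by (auto simp: machines_replace)
  then show thesis
    using assms that child_replace by auto
qed

lemma states_exchange: "child Z A q = Some B \<Longrightarrow> q \<in> states (exchange A)"
  using kept childD(2) unfolding exchange_def by (cases "A = M") auto

lemma is_tree_replace: "is_tree Z'"
  unfolding is_tree_def
proof (intro conjI allI impI; (elim conjE)?)
  fix W q N
  assume "child Z' W q = Some N"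
  then obtain A B where AB: "W = exchange A" "N = exchange B" "child Z A q = Some B"
    by (rule child_replaceD)
  then show "W \<in> machines Z'" "q \<in> states W" "N \<in> machines Z'"
    using childD[OF AB(3)] states_exchange by (simp_all add: machines_replace)
next
  fix W q W' q' N
  assume "child Z' W q = Some N" "child Z' W' q' = Some N"
  then obtain A B A' B' where AB: "W = exchange A" "N = exchange B" "child Z A q = Some B"
    "W' = exchange A'" "N = exchange B'" "child Z A' q' = Some B'"
    by (elim child_replaceD)
  then have "B = B'"
    using exchange_inj childD(3) by metis
  with AB show "W = W'" "q = q'"
    using child_inj by blast+
next
  let ?R = "root_mm Z"
  have "is_root Z' (exchange ?R)"
    unfolding is_root_def
  proof (intro conjI allI notI)
    show "exchange ?R \<in> machines Z'"
      using root_mm_machine by (simp add: machines_replace)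
    fix W q
    assume "child Z' W q = Some (exchange ?R)"
    then obtain A B where AB: "exchange ?R = exchange B" "child Z A q = Some B"
      by (rule child_replaceD)
    then have "B = ?R"
      using exchange_inj childD(3) root_mm_machine by metis
    then show False
      using childD(4)[OF AB(2)] not_edge_root by blast
  qed
  moreover have "(exchange ?R, exchange N) \<in> (edges Z')\<^sup>*" if "(?R, N) \<in> (edges Z)\<^sup>*" for N
    using that
  proof induction
    case (step A B)
    then have "(exchange A, exchange B) \<in> edges Z'"
      using child_replace edge_machines by (fastforce simp: edges_def)
    with step.IH show ?case
      by (rule rtrancl_into_rtrancl)
  qed simp
  ultimately show "\<exists>R. is_root Z' R \<and> (\<forall>N\<in>machines Z'. (R, N) \<in> (edges Z')\<^sup>*)"
    using root_mm_reaches by (auto simp: machines_replace)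
qed

lemma is_himm_replace: "is_himm Z'"
  unfolding is_himm_def
proof (intro conjI ballI impI)
  show "finite (machines Z')"
    using finite_machines by (simp add: machines_replace)
next
  fix N
  assume "N \<in> machines Z'"
  then show "is_mm N"
    using machine_is_mm M'(1) by (auto simp: machines_replace exchange_def)
next
  have io: "inputs N = inputs M \<and> outputs N = outputs M" if "N \<in> machines Z'" for N
  proof -
    obtain K where K: "K \<in> machines Z" "N = exchange K"
      using \<open>N \<in> machines Z'\<close> by (auto simp: machines_replace)
    then show ?thesis
      using M'(2,3) same_inputs[OF K(1) M] same_outputs[OF K(1) M] by (simp add: exchange_def)
  qed
  fix A B
  assume AB: "A \<in> machines Z'" "B \<in> machines Z'"
  then show "inputs A = inputs B" "outputs A = outputs B"
    using io[OF AB(1)] io[OF AB(2)] by simp_all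
  assume "A \<noteq> B"
  show "states A \<inter> states B = {}"
  proof -
    obtain K L where KL: "K \<in> machines Z" "A = exchange K" "L \<in> machines Z" "B = exchange L" "K \<noteq> L"
      using AB \<open>A \<noteq> B\<close> by (auto simp: machines_replace)
    then show ?thesis
      using fresh[OF KL(1)] fresh[OF KL(3)] disjoint_states[OF KL(1,3,5)]
      by (cases "K = M"; cases "L = M") (simp_all add: exchange_def Int_commute)
  qed
next
  show "is_tree Z'"
    by (rule is_tree_replace)
qed

text \<open>The renaming is felt only in the arcs of \<open>M'\<close> and of its parent; every
  other machine keeps its arcs and its children.\<close>

lemma sound_entry_replace:
  assumes "\<And>N. N \<in> machines Z \<Longrightarrow> N \<notin> marked \<sigma> \<Longrightarrow> N \<noteq> M \<Longrightarrow> sound_entry Z \<sigma> N"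
    and "N \<in> machines Z'" "N \<notin> marked \<sigma>" "N \<noteq> M'" "\<forall>q. child Z' N q \<noteq> Some M'"
  shows "sound_entry Z' \<sigma> N"
proof -
  have N: "N \<in> machines Z" "N \<noteq> M"
    using assms(2,4) by (auto simp: machines_replace exchange_def split: if_splits)
  have "child Z' N = child Z N"
  proof
    fix q
    have "child Z N q \<noteq> Some M"
      using assms(5) child_replace_other[OF N, of q] by (auto simp: exchange_M)
    then show "child Z' N q = child Z N q"
      using child_replace_other[OF N, of q] by (cases "child Z N q") (auto simp: exchange_def)
  qed
  then show ?thesis
    by (rule sound_entry_cong[OF assms(1)[OF N(1) assms(3) N(2)]]) simp_all
qed

lemma sound_memo_replace:
  assumes "\<And>N. N \<in> machines Z \<Longrightarrow> N \<notin> marked \<sigma> \<Longrightarrow> N \<noteq> M \<Longrightarrow> sound_entry Z \<sigma> N"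
  shows "sound_memo Z' (mark Z' M' \<sigma>)"
  using is_himm_replace M'_machine sound_entry_replace[OF assms] by (rule sound_memo_mark)

end

text \<open>Here \<open>q\<close> is already a state of \<open>M\<close> with a terminal arc. Thus
  adding a hierarchy is a replacement followed by a connection, and a composition is a series of
  connections.\<close>

locale connection = hierarchy Z + added: hierarchy Zadd for Z Zadd :: "('q, 'x) himm" +
  fixes M :: "('q, 'x, real) mm" and q :: 'q
  assumes M: "M \<in> machines Z" and q: "q \<in> states M" "child Z M q = None"
    and disjoint: "all_states Z \<inter> all_states Zadd = {}"
    and io: "N \<in> machines Zadd \<Longrightarrow> inputs N = inputs M \<and> outputs N = outputs M"
begin

abbreviation Z' where "Z' \<equiv> connect Z M q Zadd"

lemma disjoint_machines: "N \<in> machines Z \<Longrightarrow> N \<in> machines Zadd \<Longrightarrow> False"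
  using disjoint is_mmD(3)[OF machine_is_mm] by (auto simp: all_states_def)

lemma machines_connect: "machines Z' = machines Z \<union> machines Zadd"
  by (simp add: connect_def join_def)

lemma child_connect: "child Z' W p = (if W = M \<and> p = q then Some (root_mm Zadd)
    else if W \<in> machines Zadd then child Zadd W p else child Z W p)"
  by (simp add: connect_def join_def)

lemma child_connect_left: "N \<in> machines Z \<Longrightarrow> N \<noteq> M \<Longrightarrow> child Z' N = child Z N"
  using disjoint_machines by (intro ext) (auto simp: child_connect)

lemma child_connect_right: "N \<in> machines Zadd \<Longrightarrow> child Z' N = child Zadd N"
  using disjoint_machines M by (intro ext) (auto simp: child_connect)

lemma child_connectD:
  assumes "child Z' W p = Some N"
  obtains (new) "W = M" "p = q" "N = root_mm Zadd"
  | (left) "child Z W p = Some N"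
  | (right) "child Zadd W p = Some N"
proof (cases "W = M \<and> p = q")
  case True
  then show thesis
    using assms new by (simp add: child_connect)
next
  case False
  then show thesis
    using assms left right by (cases "W \<in> machines Zadd") (simp_all only: child_connect if_True if_False)
qed

lemma is_tree_connect: "is_tree Z'"
  unfolding is_tree_def
proof (intro conjI allI impI; (elim conjE)?)
  fix W p N
  assume "child Z' W p = Some N"
  then have "W \<in> machines Z' \<and> p \<in> states W \<and> N \<in> machines Z'"
  proof (cases rule: child_connectD)
    case new
    then show ?thesis
      using M q(1) added.root_mm_machine by (simp add: machines_connect)
  next
    case left
    then show ?thesis
      using childD[OF left] by (simp add: machines_connect)
  next
    case right
    then show ?thesis
      using added.childD[OF right] by (simp add: machines_connect)
  qed
  then show "W \<in> machines Z'" "p \<in> states W" "N \<in> machines Z'"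
    by simp_all
next
  fix W p W' p' N
  assume *: "child Z' W p = Some N" "child Z' W' p' = Some N"
  \<comment> \<open>Without an incoming arc in \<open>Zadd\<close>, the root of \<open>Zadd\<close>
    has the new arc as its only one.\<close>
  have root: "child Zadd A r \<noteq> Some (root_mm Zadd)" for A r
    using added.childD(4) added.not_edge_root by blast
  have left: "N \<in> machines Z" if "child Z A r = Some N" for A r
    using that by (rule childD(3))
  have right: "N \<in> machines Zadd" if "child Zadd A r = Some N" for A r
    using that by (rule added.childD(3))
  have "W = W' \<and> p = p'"
    using *(1)
  proof (cases rule: child_connectD)
    case new
    from *(2) show ?thesis
      using new root left disjoint_machines added.root_mm_machine by (cases rule: child_connectD) blast+
  next
    case left': left
    from *(2) show ?thesis
      using left' left right disjoint_machines added.root_mm_machine child_inj by (cases rule: child_connectD) blast+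
  next
    case right': right
    from *(2) show ?thesis
      using right' left right root disjoint_machines added.child_inj by (cases rule: child_connectD) blast+
  qed
  then show "W = W'" "p = p'"
    by simp_all
next
  let ?R = "root_mm Z"
  have edge_left: "edges Z \<subseteq> edges Z'"
  proof clarify
    fix A B
    assume "(A, B) \<in> edges Z"
    then obtain p where p: "child Z A p = Some B"
      by (auto simp: edges_def)
    then have "child Z' A p = Some B"
      using childD(1)[OF p] disjoint_machines q(2) by (auto simp: child_connect)
    then show "(A, B) \<in> edges Z'"
      by (auto simp: edges_def)
  qed
  have edge_right: "edges Zadd \<subseteq> edges Z'"
  proof clarify
    fix A B
    assume "(A, B) \<in> edges Zadd"
    then obtain p where p: "child Zadd A p = Some B"
      by (auto simp: edges_def)
    then have "child Z' A p = Some B"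
      using added.childD(1)[OF p] by (simp add: child_connect_right)
    then show "(A, B) \<in> edges Z'"
      by (auto simp: edges_def)
  qed
  have new: "(M, root_mm Zadd) \<in> edges Z'"
    by (auto simp: edges_def child_connect)
  have left: "(?R, N) \<in> (edges Z')\<^sup>*" if "N \<in> machines Z" for N
    using root_mm_reaches[OF that] rtrancl_mono[OF edge_left] by blast
  have right: "(?R, N) \<in> (edges Z')\<^sup>*" if "N \<in> machines Zadd" for N
  proof -
    have "(?R, root_mm Zadd) \<in> (edges Z')\<^sup>*"
      using left[OF M] new by (rule rtrancl_into_rtrancl)
    moreover have "(root_mm Zadd, N) \<in> (edges Z')\<^sup>*"
      using added.root_mm_reaches[OF that] rtrancl_mono[OF edge_right] by blast
    ultimately show ?thesis
      by (rule rtrancl_trans)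
  qed
  have "child Z' W p \<noteq> Some ?R" for W p
  proof
    assume "child Z' W p = Some ?R"
    then show False
    proof (cases rule: child_connectD)
      case new
      then show False
        using disjoint_machines root_mm_machine added.root_mm_machine by metis
    next
      case left
      then show False
        using childD(4) not_edge_root by blast
    next
      case right
      then show False
        using disjoint_machines root_mm_machine added.childD(3) by blast
    qed
  qed
  then have "is_root Z' ?R"
    using root_mm_machine by (simp add: is_root_def machines_connect)
  then show "\<exists>R. is_root Z' R \<and> (\<forall>N\<in>machines Z'. (R, N) \<in> (edges Z')\<^sup>*)"
    using left right by (auto simp: machines_connect)
qed

lemma is_himm_connect: "is_himm Z'"
  unfolding is_himm_def
proof (intro conjI ballI impI)
  show "finite (machines Z')"
    using finite_machines added.finite_machines by (simp add: machines_connect)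
next
  fix N
  assume "N \<in> machines Z'"
  then show "is_mm N"
    using machine_is_mm added.machine_is_mm by (auto simp: machines_connect)
next
  have io': "inputs N = inputs M \<and> outputs N = outputs M" if "N \<in> machines Z'" for N
    using that io same_inputs[OF _ M] same_outputs[OF _ M] unfolding machines_connect by blast
  fix A B
  assume AB: "A \<in> machines Z'" "B \<in> machines Z'"
  then show "inputs A = inputs B" "outputs A = outputs B"
    using io'[OF AB(1)] io'[OF AB(2)] by simp_all
  have cross: "states A \<inter> states B = {}" if "A \<in> machines Z" "B \<in> machines Zadd" for A B
    using that disjoint by (auto simp: all_states_def)
  assume "A \<noteq> B"
  with AB show "states A \<inter> states B = {}"
    using cross[of A B] cross[of B A] disjoint_states[of A B] added.disjoint_states[of A B]
    unfolding machines_connect by blast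
next
  show "is_tree Z'"
    by (rule is_tree_connect)
qed

lemma sound_entry_connect_left:
  assumes "sound_entry Z \<sigma> N" "N \<in> machines Z" "N \<noteq> M" "marked \<sigma>add \<subseteq> machines Zadd"
  shows "sound_entry Z' (merge_memo \<sigma> Zadd \<sigma>add) N"
  using assms(1)
proof (rule sound_entry_cong)
  have away: "K \<notin> machines Zadd" if "K \<in> machines Z" for K
    using that disjoint_machines by blast
  show "child Z' N = child Z N"
    using assms by (simp add: child_connect_left)
  show "table (merge_memo \<sigma> Zadd \<sigma>add) N = table \<sigma> N"
    using away[OF assms(2)] by (simp add: merge_memo_def)
  fix p K
  assume K: "child Z N p = Some K" "K \<notin> marked \<sigma>"
  then show "K \<notin> marked (merge_memo \<sigma> Zadd \<sigma>add) \<and> table (merge_memo \<sigma> Zadd \<sigma>add) K = table \<sigma> K"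
    using away[OF childD(3)[OF K(1)]] assms(4) by (auto simp: merge_memo_def)
qed

lemma sound_entry_connect_right:
  assumes "sound_entry Zadd \<sigma>add N" "N \<in> machines Zadd" "marked \<sigma> \<inter> machines Zadd = {}"
  shows "sound_entry Z' (merge_memo \<sigma> Zadd \<sigma>add) N"
  using assms(1)
proof (rule sound_entry_cong)
  show "child Z' N = child Zadd N"
    using assms by (simp add: child_connect_right)
  show "table (merge_memo \<sigma> Zadd \<sigma>add) N = table \<sigma>add N"
    using assms(2) by (simp add: merge_memo_def)
  fix p K
  assume K: "child Zadd N p = Some K" "K \<notin> marked \<sigma>add"
  then show "K \<notin> marked (merge_memo \<sigma> Zadd \<sigma>add) \<and> table (merge_memo \<sigma> Zadd \<sigma>add) K = table \<sigma>add K"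
    using added.childD(3)[OF K(1)] assms(3) by (auto simp: merge_memo_def)
qed

text \<open>\<open>M\<close> is the only machine whose arcs change; being marked, it owes no sound
  entry. This serves compositions, where the new root is marked from the outset.\<close>

lemma sound_memo_connect:
  assumes "sound_memo Z \<sigma>" "sound_memo Zadd \<sigma>add" "M \<in> marked \<sigma>"
  shows "sound_memo Z' (merge_memo \<sigma> Zadd \<sigma>add)"
  unfolding sound_memo_def
proof (intro conjI ballI)
  show "marked (merge_memo \<sigma> Zadd \<sigma>add) \<subseteq> machines Z'"
    using sound_memoD(1)[OF assms(1)] sound_memoD(1)[OF assms(2)] by (auto simp: merge_memo_def machines_connect)
  fix N
  assume "N \<in> machines Z' - marked (merge_memo \<sigma> Zadd \<sigma>add)"
  then have N: "N \<in> machines Z \<or> N \<in> machines Zadd" "N \<notin> marked \<sigma>" "N \<notin> marked \<sigma>add"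
    by (auto simp: merge_memo_def machines_connect)
  have "marked \<sigma> \<inter> machines Zadd = {}"
    using sound_memoD(1)[OF assms(1)] disjoint_machines by blast
  with N show "sound_entry Z' (merge_memo \<sigma> Zadd \<sigma>add) N"
    using sound_entry_connect_left sound_entry_connect_right sound_memoD assms by metis
qed

end

section \<open>Pruning a subtree\<close>

context hierarchy
begin

text \<open>The last two facts carry the argument: the removed set is closed under children, and the
  pruned arc is the only way into it from outside.\<close>

lemma prune_facts:
  fixes M q
  defines "D \<equiv> (case child Z M q of Some N \<Rightarrow> subtree Z N | None \<Rightarrow> {})"
  assumes M: "M \<in> machines Z"
  shows "machines (prune Z M q) = machines Z - D"
    and "child (prune Z M q) W p = (if W \<in> D \<or> W = M \<and> p = q then None else child Z W p)"
    and "M \<notin> D"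
    and "child Z W p = Some K \<Longrightarrow> W \<in> D \<Longrightarrow> K \<in> D"
    and "child Z W p = Some K \<Longrightarrow> K \<in> D \<Longrightarrow> W \<in> D \<or> W = M \<and> p = q"
proof -
  show "machines (prune Z M q) = machines Z - D"
    "child (prune Z M q) W p = (if W \<in> D \<or> W = M \<and> p = q then None else child Z W p)"
    by (simp_all add: prune_def D_def Let_def)
  show "M \<notin> D"
  proof (cases "child Z M q")
    case (Some N)
    show ?thesis
    proof
      assume "M \<in> D"
      then have "(N, M) \<in> (edges Z)\<^sup>*"
        using Some by (simp add: D_def subtree_def)
      with childD(4)[OF Some] have "(M, M) \<in> (edges Z)\<^sup>+"
        by (rule rtrancl_into_trancl2)
      with acyclic_edges show False
        by blast
    qed
  qed (simp add: D_def)
  show "K \<in> D" if "child Z W p = Some K" "W \<in> D"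
    using that subtree_trans[OF _ subtree_child] by (auto simp: D_def split: option.splits)
  show "W \<in> D \<or> W = M \<and> p = q" if K: "child Z W p = Some K" "K \<in> D"
  proof -
    obtain N where N: "child Z M q = Some N" "(N, K) \<in> (edges Z)\<^sup>*"
      using K(2) by (auto simp: D_def subtree_def split: option.splits)
    from N(2) show ?thesis
    proof (cases rule: rtranclE)
      case base
      then show ?thesis
        using child_inj N(1) K(1) by blast
    next
      case (step P)
      then have "P = W"
        using edge_parent_unique childD(4)[OF K(1)] by blast
      with step N(1) show ?thesis
        by (simp add: D_def subtree_def)
    qed
  qed
qed

lemma is_himm_prune:
  assumes "M \<in> machines Z"
  shows "is_himm (prune Z M q)"
proof -
  define D where "D = (case child Z M q of Some N \<Rightarrow> subtree Z N | None \<Rightarrow> {})"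
  let ?Z = "prune Z M q"
  note facts = prune_facts[OF assms, where q = q, folded D_def]
  have child: "child Z W p = Some N \<and> W \<notin> D \<and> N \<notin> D" if "child ?Z W p = Some N" for W p N
    using that facts(2)[of W p] facts(5)[of W p N] by (auto split: if_splits)
  \<comment> \<open>As no arc leads out of \<open>D\<close>, a path from the root to a surviving
    machine has avoided \<open>D\<close> throughout.\<close>
  have reach: "N \<notin> D \<longrightarrow> (root_mm Z, N) \<in> (edges ?Z)\<^sup>*" if "(root_mm Z, N) \<in> (edges Z)\<^sup>*" for N
    using that
  proof induction
    case (step A B)
    show ?case
    proof
      assume "B \<notin> D"
      obtain p where p: "child Z A p = Some B"
        using step.hyps(2) by (auto simp: edges_def)
      have A: "A \<notin> D"
        using facts(4)[OF p] \<open>B \<notin> D\<close> by blast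
      have "\<not> (A = M \<and> p = q)"
        using \<open>B \<notin> D\<close> p by (auto simp: D_def)
      with A p have "(A, B) \<in> edges ?Z"
        using facts(2)[of A p] by (auto simp: edges_def)
      with step.IH A show "(root_mm Z, B) \<in> (edges ?Z)\<^sup>*"
        by (blast intro: rtrancl_into_rtrancl)
    qed
  qed simp
  have "root_mm Z \<notin> D"
  proof
    assume "root_mm Z \<in> D"
    then obtain N where N: "child Z M q = Some N" "(N, root_mm Z) \<in> (edges Z)\<^sup>*"
      by (auto simp: D_def subtree_def split: option.splits)
    from N(2) show False
      using not_edge_root childD(4)[OF N(1)] by (cases rule: rtranclE) auto
  qed
  then have "is_root ?Z (root_mm Z)"
    using root_mm_root child facts(1) unfolding is_root_def by blast
  moreover have "\<forall>N\<in>machines ?Z. (root_mm Z, N) \<in> (edges ?Z)\<^sup>*"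
    using reach root_mm_reaches facts(1) by blast
  moreover have "\<forall>W p N. child ?Z W p = Some N \<longrightarrow> W \<in> machines ?Z \<and> p \<in> states W \<and> N \<in> machines ?Z"
    using child childD facts(1) by blast
  moreover have "\<forall>W p W' p' N. child ?Z W p = Some N \<and> child ?Z W' p' = Some N \<longrightarrow> W = W' \<and> p = p'"
    using child child_inj by blast
  ultimately have "is_tree ?Z"
    unfolding is_tree_def by blast
  then show ?thesis
    using facts(1) finite_machines machine_is_mm same_inputs same_outputs disjoint_states
    unfolding is_himm_def by simp
qed

end

section \<open>Compositions as repeated connections\<close>

lemma is_himm_single: "is_mm M \<Longrightarrow> is_himm \<lparr>machines = {M}, child = (\<lambda>W q. None)\<rparr>"
  by (simp add: is_himm_def is_tree_def is_root_def)

text \<open>\<open>compose\<close> installs all arcs of the new root at once, \<open>connect\<close>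
  one at a time. The results agree because joining hierarchies that do not contain \<open>M\<close>
  leaves the arcs of \<open>M\<close> alone.\<close>

lemma compose_Cons:
  assumes "M \<notin> machines Z" "\<And>Z'. Z' \<in> set Zs \<Longrightarrow> M \<notin> machines Z'"
  shows "compose M (q # qs) (Z # Zs) = connect (compose M qs Zs) M q Z"
proof -
  \<comment> \<open>The composition with the arc table \<open>f\<close> of the root as a parameter:
    changing \<open>f\<close> affects the arcs of \<open>M\<close> and nothing else.\<close>
  define B where "B = (\<lambda>f. foldr (\<lambda>Z' Z. join Z Z') Zs
    \<lparr>machines = {M}, child = (\<lambda>W q. if W = M then f q else None)\<rparr> :: ('a, 'b) himm)"
  have B: "machines (B f) = machines (B g) \<and> child (B f) M = f \<and> (\<forall>W. W \<noteq> M \<longrightarrow> child (B f) W = child (B g) W)" for f g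
    unfolding B_def using assms(2)
    by (induction Zs) (simp_all add: join_def fun_eq_iff)
  let ?f = "map_of (zip qs (map root_mm Zs))" and ?g = "map_of (zip (q # qs) (map root_mm (Z # Zs)))"
  have eq: "compose M (q # qs) (Z # Zs) = join (B ?g) Z" "compose M qs Zs = B ?f"
    by (simp_all only: compose_def B_def foldr.simps o_apply)
  have "machines (B ?g) = machines (B ?f)" "child (B ?g) M = ?g" "child (B ?f) M = ?f"
    "\<And>W. W \<noteq> M \<Longrightarrow> child (B ?g) W = child (B ?f) W"
    using B[of ?g ?f] B[of ?f ?g] by blast+
  then show ?thesis
    unfolding eq using assms(1) by (auto simp: connect_def join_def fun_eq_iff)
qed

text \<open>Generalised for induction on \<open>Hs\<close>: \<open>qs\<close> need not exhaust the
  states of \<open>M\<close>, and the last conjuncts record which machines are present and that the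
  arcs outside \<open>qs\<close> are still terminal, as the next connection requires.\<close>

lemma compose_sound:
  fixes M :: "('q, 'x, real) mm" and t :: "('q, 'x, real) mm \<Rightarrow> ('q, 'x) exit_result"
  assumes "is_mm M" "distinct qs" "set qs \<subseteq> states M" "length Hs \<le> length qs"
    and "\<forall>(Z, \<sigma>)\<in>set Hs. is_himm Z \<and> sound_memo Z \<sigma>"
    and "\<forall>(Z, \<sigma>)\<in>set Hs. \<forall>N\<in>machines Z. inputs N = inputs M \<and> outputs N = outputs M"
    and "\<forall>(Z, \<sigma>)\<in>set Hs. all_states Z \<inter> states M = {}"
    and "\<forall>i<length Hs. \<forall>j<i. all_states (fst (Hs ! i)) \<inter> all_states (fst (Hs ! j)) = {}"
  defines "\<sigma>s \<equiv> foldr (\<lambda>(Z, \<sigma>) \<sigma>'. merge_memo \<sigma>' Z \<sigma>) Hs \<lparr>marked = {M}, table = t\<rparr>"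
  shows "is_himm (compose M qs (map fst Hs)) \<and> sound_memo (compose M qs (map fst Hs)) \<sigma>s \<and>
    M \<in> machines (compose M qs (map fst Hs)) \<and> M \<in> marked \<sigma>s \<and>
    machines (compose M qs (map fst Hs)) = insert M (\<Union>H\<in>set Hs. machines (fst H)) \<and>
    (\<forall>q. q \<notin> set qs \<longrightarrow> child (compose M qs (map fst Hs)) M q = None)"
  using assms(2-8) unfolding \<sigma>s_def
proof (induction Hs arbitrary: qs)
  case Nil
  have "compose M qs (map fst []) = \<lparr>machines = {M}, child = (\<lambda>W q. None)\<rparr>"
    by (simp add: compose_def fun_eq_iff)
  then show ?case
    using is_himm_single[OF assms(1)] by (simp add: sound_memo_def)
next
  case (Cons H Hs)
  obtain q qs' where qs: "qs = q # qs'"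
    using Cons.prems(3) by (cases qs) auto
  obtain Z \<sigma> where H: "H = (Z, \<sigma>)"
    by fastforce
  let ?Z = "compose M qs' (map fst Hs)"
    and ?\<sigma> = "foldr (\<lambda>(Z, \<sigma>) \<sigma>'. merge_memo \<sigma>' Z \<sigma>) Hs \<lparr>marked = {M}, table = t\<rparr>"
  have pairwise: "all_states (fst (Hs ! i)) \<inter> all_states (fst (Hs ! j)) = {}" if "i < length Hs" "j < i" for i j
    using Cons.prems(7)[rule_format, of "Suc i" "Suc j"] that by simp
  have IH: "is_himm ?Z" "sound_memo ?Z ?\<sigma>" "M \<in> machines ?Z" "M \<in> marked ?\<sigma>"
    "machines ?Z = insert M (\<Union>H\<in>set Hs. machines (fst H))"
    "\<forall>q. q \<notin> set qs' \<longrightarrow> child ?Z M q = None"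
    using Cons.IH[of qs'] Cons.prems(1-6) pairwise by (simp_all add: qs)
  have not_in: "M \<notin> machines (fst H')" if "H' \<in> set (H # Hs)" for H'
  proof
    assume "M \<in> machines (fst H')"
    then have "init M \<in> all_states (fst H')"
      using is_mmD(3)[OF assms(1)] by (auto simp: all_states_def)
    moreover have "all_states (fst H') \<inter> states M = {}"
      using bspec[OF Cons.prems(6) that] by (simp add: case_prod_unfold)
    ultimately show False
      using is_mmD(3)[OF assms(1)] by blast
  qed
  have "all_states Z \<inter> all_states (fst H') = {}" if "H' \<in> set Hs" for H'
  proof -
    obtain i where "i < length Hs" "H' = Hs ! i"
      using \<open>H' \<in> set Hs\<close> by (auto simp: in_set_conv_nth)
    then show ?thesis
      using Cons.prems(7)[rule_format, of "Suc i" 0] H by (simp add: Int_commute)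
  qed
  moreover have "all_states Z \<inter> states M = {}"
    using Cons.prems(6) H by simp
  ultimately have disjoint: "all_states ?Z \<inter> all_states Z = {}"
    unfolding all_states_def IH(5) by blast
  interpret connection ?Z Z M q
  proof unfold_locales
    show "is_himm ?Z" "is_himm Z" "M \<in> machines ?Z" "all_states ?Z \<inter> all_states Z = {}"
      using IH disjoint Cons.prems(4) H by simp_all
    show "q \<in> states M" "child ?Z M q = None"
      using Cons.prems(1,2) IH(6) by (simp_all add: qs)
    show "N \<in> machines Z \<Longrightarrow> inputs N = inputs M \<and> outputs N = outputs M" for N
      using Cons.prems(5) H by simp
  qed
  have eq: "compose M qs (map fst (H # Hs)) = connect ?Z M q Z"
    unfolding qs list.map H fst_conv
  proof (rule compose_Cons)
    show "M \<notin> machines Z"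
      using not_in[of H] H by simp
    fix Z'
    assume "Z' \<in> set (map fst Hs)"
    then obtain H' where "H' \<in> set Hs" "Z' = fst H'"
      unfolding set_map by (rule imageE)
    then show "M \<notin> machines Z'"
      using not_in[of H'] by simp
  qed
  have memo_eq: "foldr (\<lambda>(Z, \<sigma>) \<sigma>'. merge_memo \<sigma>' Z \<sigma>) (H # Hs) \<lparr>marked = {M}, table = t\<rparr> = merge_memo ?\<sigma> Z \<sigma>"
    by (simp add: H)
  have "sound_memo Z' (merge_memo ?\<sigma> Z \<sigma>)"
    using IH(2,4) Cons.prems(4) H by (intro sound_memo_connect) simp_all
  moreover have "M \<in> marked (merge_memo ?\<sigma> Z \<sigma>)"
    using IH(4) by (simp add: merge_memo_def)
  moreover have "child Z' M p = None" if "p \<notin> set qs" for p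
    using that IH(6) not_in[of H] H by (simp add: child_connect qs)
  ultimately show ?case
    unfolding eq memo_eq using is_himm_connect IH(5) H by (auto simp: machines_connect)
qed

section \<open>Preservation of the invariant by every modification\<close>

lemma is_mm_add_state:
  assumes "is_mm M" "\<forall>y\<in>inputs M. g y \<in> outputs M"
  shows "is_mm (mm_add_state M q g)"
  using assms unfolding is_mm_def mm_add_state_def by auto

lemma is_mm_remove_state:
  assumes "is_mm M" "q \<noteq> init M"
  shows "is_mm (mm_remove_state M q)"
  using assms unfolding is_mm_def mm_remove_state_def by (auto split: if_splits)

lemma states_add_state: "states (mm_add_state M q g) = insert q (states M)"
  and states_remove_state: "states (mm_remove_state M q) = states M - {q}"
  and io_add_state: "inputs (mm_add_state M q g) = inputs M" "outputs (mm_add_state M q g) = outputs M"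
  and io_remove_state: "inputs (mm_remove_state M q) = inputs M" "outputs (mm_remove_state M q) = outputs M"
  by (simp_all add: mm_add_state_def mm_remove_state_def)

lemma machine_replacement_add_state:
  assumes "is_himm Z" "M \<in> machines Z" "q \<notin> all_states Z" "\<forall>y\<in>inputs M. g y \<in> outputs M"
  shows "machine_replacement Z M (mm_add_state M q g)"
proof -
  interpret hierarchy Z
    by unfold_locales (rule assms(1))
  show ?thesis
  proof unfold_locales
    show "is_mm (mm_add_state M q g)"
      using is_mm_add_state[OF machine_is_mm[OF assms(2)] assms(4)] .
    fix N
    assume N: "N \<in> machines Z" "N \<noteq> M"
    then have "q \<notin> states N"
      using assms(3) by (auto simp: all_states_def)
    then show "states (mm_add_state M q g) \<inter> states N = {}"
      using disjoint_states[OF assms(2) N(1)] N(2) by (simp add: states_add_state)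
  next
    fix p N
    assume "child Z M p = Some N"
    then show "p \<in> states (mm_add_state M q g)"
      using childD(2) by (simp add: states_add_state)
  qed (simp_all add: io_add_state assms)
qed

lemma machine_replacement_same_states:
  assumes "is_himm Z" "M \<in> machines Z" "is_mm M'" "states M' \<subseteq> states M"
    and "inputs M' = inputs M" "outputs M' = outputs M"
    and "\<And>q N. child Z M q = Some N \<Longrightarrow> q \<in> states M'"
  shows "machine_replacement Z M M'"
proof -
  interpret hierarchy Z
    by unfold_locales (rule assms(1))
  show ?thesis
  proof unfold_locales
    fix N
    assume "N \<in> machines Z" "N \<noteq> M"
    then show "states M' \<inter> states N = {}"
      using disjoint_states[OF assms(2), of N] assms(4) by blast
  qed (use assms in auto)
qed

lemma marked_himm_sound:
  assumes "marked_himm Z \<sigma>"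
  shows "is_himm Z \<and> sound_memo Z \<sigma>"
  using assms
proof (induction rule: marked_himm.induct)
  case (initialise Z t)
  then show ?case
    by (simp add: sound_memo_def)
next
  case (compute Z \<sigma> r \<sigma>')
  then interpret hierarchy Z
    by unfold_locales simp
  show ?case
    using compute compute_sound(1) by blast
next
  case (add_himm Z \<sigma> Zadd \<sigma>add M q g M' Z')
  have Z: "is_himm Z" "sound_memo Z \<sigma>" and Zadd: "is_himm Zadd" "sound_memo Zadd \<sigma>add"
    using add_himm.IH by simp_all
  interpret rep: machine_replacement Z M M'
    unfolding \<open>M' = mm_add_state M q g\<close>
    using Z(1) add_himm.hyps by (intro machine_replacement_add_state) auto
  have M': "states M' = insert q (states M)" "inputs M' = inputs M" "outputs M' = outputs M"
    using \<open>M' = mm_add_state M q g\<close> by (simp_all add: states_add_state io_add_state)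
  have states: "all_states (replace_mm Z M M') \<subseteq> insert q (all_states Z)"
    using M' rep.M by (auto simp: all_states_def rep.machines_replace rep.exchange_def split: if_splits)
  interpret connection "replace_mm Z M M'" Zadd M' q
  proof unfold_locales
    show "is_himm (replace_mm Z M M')" "is_himm Zadd" "M' \<in> machines (replace_mm Z M M')" "q \<in> states M'"
      using rep.is_himm_replace Zadd rep.M'_machine M' by simp_all
    have "child Z M q = None"
      using rep.childD(2) rep.M \<open>q \<notin> all_states Z \<union> all_states Zadd\<close> by (force simp: all_states_def)
    then show "child (replace_mm Z M M') M' q = None"
      by (simp add: rep.child_replace_M')
    show "all_states (replace_mm Z M M') \<inter> all_states Zadd = {}"
      using states \<open>q \<notin> all_states Z \<union> all_states Zadd\<close> \<open>all_states Z \<inter> all_states Zadd = {}\<close> by blast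
    show "N \<in> machines Zadd \<Longrightarrow> inputs N = inputs M' \<and> outputs N = outputs M'" for N
      using add_himm.hyps M' by simp
  qed
  \<comment> \<open>No \<open>mark\<close> runs between replacement and connection, so the
    intermediate memory need not be sound. Entries are therefore followed machine by machine, and
    \<open>mark\<close> is accounted for once at the end.\<close>
  have "sound_memo (connect (replace_mm Z M M') M' q Zadd)
      (mark (connect (replace_mm Z M M') M' q Zadd) M' (merge_memo \<sigma> Zadd \<sigma>add))"
  proof (rule sound_memo_mark[OF is_himm_connect])
    show "M' \<in> machines (connect (replace_mm Z M M') M' q Zadd)"
      using rep.M'_machine by (simp add: machines_connect)
    fix N
    assume N: "N \<in> machines (connect (replace_mm Z M M') M' q Zadd)" "N \<notin> marked (merge_memo \<sigma> Zadd \<sigma>add)"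
      "N \<noteq> M'" "\<forall>p. child (connect (replace_mm Z M M') M' q Zadd) N p \<noteq> Some M'"
    then have unmarked: "N \<notin> marked \<sigma>" "N \<notin> marked \<sigma>add"
      by (simp_all add: merge_memo_def)
    show "sound_entry (connect (replace_mm Z M M') M' q Zadd) (merge_memo \<sigma> Zadd \<sigma>add) N"
    proof (cases "N \<in> machines Zadd")
      case True
      have "K \<notin> machines Zadd" if "K \<in> machines Z" for K
        using that \<open>all_states Z \<inter> all_states Zadd = {}\<close> is_mmD(3)[OF rep.machine_is_mm[OF that]]
        by (auto simp: all_states_def)
      then have "marked \<sigma> \<inter> machines Zadd = {}"
        using sound_memoD(1)[OF Z(2)] by blast
      with True show ?thesis
        using sound_entry_connect_right sound_memoD(2)[OF Zadd(2)] unmarked by blast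
    next
      case False
      then have N': "N \<in> machines (replace_mm Z M M')"
        using N(1) by (simp add: machines_connect)
      have "\<forall>p. child (replace_mm Z M M') N p \<noteq> Some M'"
        using N(4) child_connect_left[OF N' N(3)] by simp
      then have "sound_entry (replace_mm Z M M') \<sigma> N"
        using rep.sound_entry_replace[OF sound_memoD(2)[OF Z(2)]] N' N(3) unmarked by blast
      then show ?thesis
        using sound_entry_connect_left N' N(3) sound_memoD(1)[OF Zadd(2)] by blast
    qed
  qed
  with is_himm_connect show ?case
    using \<open>Z' = connect (replace_mm Z M M') M' q Zadd\<close> by simp
next
  case (add_state Z \<sigma> M q g M' Z')
  have Z: "is_himm Z" "sound_memo Z \<sigma>"
    using add_state.IH by simp_all
  interpret rep: machine_replacement Z M M'
    unfolding \<open>M' = mm_add_state M q g\<close>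
    using Z(1) add_state.hyps by (intro machine_replacement_add_state) auto
  show ?case
    unfolding \<open>Z' = replace_mm Z M M'\<close>
    using rep.is_himm_replace rep.sound_memo_replace[OF sound_memoD(2)[OF Z(2)]] by simp
next
  case (subtract_state Z \<sigma> M q M' Z')
  have Z: "is_himm Z" "sound_memo Z \<sigma>"
    using subtract_state.IH by simp_all
  interpret Z: hierarchy Z
    by unfold_locales (rule Z(1))
  note prune = Z.prune_facts[OF subtract_state.hyps(2), where q = q]
  interpret machine_replacement "prune Z M q" M M'
  proof (rule machine_replacement_same_states)
    show "is_himm (prune Z M q)"
      using Z.is_himm_prune subtract_state.hyps(2) by blast
    show "M \<in> machines (prune Z M q)"
      using prune(1,3) subtract_state.hyps(2) by blast
    show "is_mm M'"
      unfolding \<open>M' = mm_remove_state M q\<close>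
      using Z.machine_is_mm subtract_state.hyps by (intro is_mm_remove_state) auto
    show "states M' \<subseteq> states M" "inputs M' = inputs M" "outputs M' = outputs M"
      using subtract_state.hyps by (auto simp: states_remove_state io_remove_state)
    fix p N
    assume "child (prune Z M q) M p = Some N"
    then have "p \<noteq> q" "child Z M p = Some N"
      using prune(2)[of M p] by (auto split: if_splits)
    then show "p \<in> states M'"
      using Z.childD(2) subtract_state.hyps by (simp add: states_remove_state)
  qed
  have "sound_entry (prune Z M q) \<sigma> N" if N: "N \<in> machines (prune Z M q)" "N \<notin> marked \<sigma>" "N \<noteq> M" for N
  proof (rule sound_entry_cong)
    show "sound_entry Z \<sigma> N"
      using N prune(1) sound_memoD(2)[OF Z(2)] by blast
    show "child (prune Z M q) N = child Z N"
      using N prune(1,2) by auto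
  qed simp_all
  then show ?case
    unfolding \<open>Z' = replace_mm (prune Z M q) M M'\<close>
    using is_himm_replace sound_memo_replace by simp
next
  case (modify_arcs Z \<sigma> M M' d g s Z')
  have Z: "is_himm Z" "sound_memo Z \<sigma>"
    using modify_arcs.IH by simp_all
  interpret Z: hierarchy Z
    by unfold_locales (rule Z(1))
  interpret rep: machine_replacement Z M M'
    using Z(1) modify_arcs.hyps(2,4)
    by (rule machine_replacement_same_states) (simp_all add: \<open>M' = _\<close> Z.childD(2))
  show ?case
    unfolding \<open>Z' = replace_mm Z M M'\<close>
    using rep.is_himm_replace rep.sound_memo_replace[OF sound_memoD(2)[OF Z(2)]] by simp
next
  case (composition Hs M qs t)
  have "\<forall>(Z, \<sigma>)\<in>set Hs. is_himm Z \<and> sound_memo Z \<sigma>"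
    using composition.IH by blast
  then show ?case
    using compose_sound[of M qs Hs t] composition.hyps by simp
qed

text \<open>Existence of a run keeps the claim about all runs from being vacuous, and the values are
  read from the final memory because \<open>r\<close> belongs to the root alone. The claim for
  \<open>exits_target\<close> is conditional: a re-entry is decided by the ancestors of
  \<open>M\<close>, on which the value computed for \<open>M\<close> does not depend.\<close>

theorem proposition1:
  fixes Z :: "('q, 'x) himm" and \<sigma> :: "('q, 'x) memo"
  assumes "marked_himm Z \<sigma>"
  shows "(\<exists>r \<sigma>'. compute_optimal_exits Z \<sigma> r \<sigma>') \<and>
    (\<forall>r \<sigma>'. compute_optimal_exits Z \<sigma> r \<sigma>' \<longrightarrow>
       r = table \<sigma>' (root_mm Z) \<and>
       (\<forall>M\<in>machines Z. \<forall>x\<in>inputs M.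
          is_optimal_exit_cost exits_subtree Z M x (fst (table \<sigma>' M x)) \<and>
          (\<not> reenters Z M x \<longrightarrow>
             is_optimal_exit_cost exits_target Z M x (fst (table \<sigma>' M x)))))"
proof (intro conjI allI impI ballI)
  interpret hierarchy Z
    using marked_himm_sound[OF assms] by unfold_locales simp
  show "\<exists>r \<sigma>'. compute_optimal_exits Z \<sigma> r \<sigma>'"
    using optimal_exit_exists[OF root_mm_machine] by (simp add: compute_optimal_exits_def)
  fix r \<sigma>'
  assume "compute_optimal_exits Z \<sigma> r \<sigma>'"
  note compute = compute_sound[OF this conjunct2[OF marked_himm_sound[OF assms]]]
  show "r = table \<sigma>' (root_mm Z)"
    by (rule compute(2))
  interpret solved_hierarchy Z "\<lambda>M x. fst (table \<sigma>' M x)"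
    using compute(1,3) by (rule unmarked_memo_solves)
  fix M x
  assume M: "M \<in> machines Z" "x \<in> inputs M"
  show "is_optimal_exit_cost exits_subtree Z M x (fst (table \<sigma>' M x))"
    using C_optimal[OF M] .
  assume "\<not> reenters Z M x"
  then show "is_optimal_exit_cost exits_target Z M x (fst (table \<sigma>' M x))"
    using C_optimal_target M by blast
qed

end
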